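(* Let $f$ and $g_1,\ldots,g_m\in\mathbb{R}[\underline{x}]$ be convex polynomials on $\mathbb{R}^n$ with $K := \{x\in\mathbb{R}^n \mid g_i(x)\le 0,\ i=1,\ldots,m\}\neq\emptyset$. Let $L:\mathbb{R}^n\times\mathbb{R}^m_+\to\mathbb{R}$ be the Lagrangian function defined by $L(x,\lambda):=f(x)+\sum_{i=1}^m\lambda_i g_i(x)$. If $L$ has a saddle-point $(x^*,\lambda^* )\in K\times\mathbb{R}^m_+$ with $\nabla^2_{xx}L(x^*,\lambda^* )\succ 0$, then, for any $c\in\mathbb{R}$ with $c>f(x^* )$, we have $$f-f(x^* )\in\mathbf{M}(-g_1,\ldots,-g_m,c-f).$$
   Context: $\mathbb{R}[\underline{x}]$ is the ring of real polynomials in $x=(x_1,\ldots,x_n)$, and $\mathbb{R}^m_+$ is the non-negative orthant. $\Sigma^2\subset\mathbb{R}[\underline{x}]$ is the set of sum-of-squares polynomials (finite sums of squares of polynomials in $\mathbb{R}[\underline{x}]$). For polynomials $p_1,\ldots,p_s$, the quadratic module they generate is $\mathbf{M}(p_1,\ldots,p_s):=\{\sigma_0+\sigma_1p_1+\cdots+\sigma_sp_s \mid \sigma_0,\ldots,\sigma_s\in\Sigma^2\}$. A pair $(x^*,\lambda^* )$ with $\lambda^*\in\mathbb{R}^m_+$ is a saddle-point of $L$ if $L(x,\lambda^* )\ge L(x^*,\lambda^* )\ge L(x^*,\lambda)$ for all $x\in\mathbb{R}^n$ and all $\lambda\in\mathbb{R}^m_+$. $\nabla^2_{xx}L$ is the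 Hessian of $L$ with respect to $x$, and $\succ 0$ means positive definite. *)

theory Defs
  imports "HOL-Analysis.Analysis" "HOL-Library.Poly_Mapping"
begin

text \<open>Formal real polynomials in the variables \<open>x\<^sub>i\<close>, \<open>i :: 'n\<close>: finitely supported maps from
  exponent vectors to coefficients, with the convolution product of \<^theory>\<open>HOL-Library.Poly_Mapping\<close>.\<close>

type_synonym 'n real_mpoly = "('n \<Rightarrow>\<^sub>0 nat) \<Rightarrow>\<^sub>0 real"

definition mpoly_const :: "real \<Rightarrow> 'n real_mpoly" where
  "mpoly_const a = Poly_Mapping.single 0 a"

definition mpoly_eval :: "'n::finite real_mpoly \<Rightarrow> real ^ 'n \<Rightarrow> real" where
  "mpoly_eval p x =
    (\<Sum>\<alpha>\<in>Poly_Mapping.keys p. Poly_Mapping.lookup p \<alpha> * (\<Prod>i\<in>UNIV. (x $ i) ^ Poly_Mapping.lookup \<alpha> i))"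

definition sos :: "'n real_mpoly set" where
  "sos = {\<sigma>. \<exists>qs. \<sigma> = (\<Sum>q\<leftarrow>qs. q ^ 2)}"

definition quadratic_module :: "('k::finite \<Rightarrow> 'n real_mpoly) \<Rightarrow> 'n real_mpoly set" where
  "quadratic_module p = {\<sigma>0 + (\<Sum>k\<in>UNIV. \<sigma> k * p k) | \<sigma>0 \<sigma>. \<sigma>0 \<in> sos \<and> (\<forall>k. \<sigma> k \<in> sos)}"

definition nonneg_orthant :: "(real ^ 'm) set" where
  "nonneg_orthant = {l. \<forall>i. 0 \<le> l $ i}"

definition feasible_set :: "('m \<Rightarrow> 'n::finite real_mpoly) \<Rightarrow> (real ^ 'n) set" where
  "feasible_set g = {x. \<forall>i. mpoly_eval (g i) x \<le> 0}"

definition lagrangian ::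
  "'n::finite real_mpoly \<Rightarrow> ('m::finite \<Rightarrow> 'n real_mpoly) \<Rightarrow> real ^ 'n \<Rightarrow> real ^ 'm \<Rightarrow> real" where
  "lagrangian f g x l = mpoly_eval f x + (\<Sum>i\<in>UNIV. l $ i * mpoly_eval (g i) x)"

definition saddle_point ::
  "(real ^ 'n \<Rightarrow> real ^ 'm \<Rightarrow> real) \<Rightarrow> real ^ 'n \<Rightarrow> real ^ 'm \<Rightarrow> bool" where
  "saddle_point L x0 l0 \<longleftrightarrow> l0 \<in> nonneg_orthant \<and>
    (\<forall>x. \<forall>l\<in>nonneg_orthant. L x l0 \<ge> L x0 l0 \<and> L x0 l0 \<ge> L x0 l)"

text \<open>The usual partial derivative wherever \<open>h\<close> is differentiable, in particular for polynomial
  functions; unspecified elsewhere.\<close>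

definition partial_deriv :: "'n \<Rightarrow> (real ^ 'n \<Rightarrow> real) \<Rightarrow> real ^ 'n::finite \<Rightarrow> real" where
  "partial_deriv i h x = frechet_derivative h (at x) (axis i 1)"

definition hessian :: "(real ^ 'n \<Rightarrow> real) \<Rightarrow> real ^ 'n::finite \<Rightarrow> real ^ 'n ^ 'n" where
  "hessian h x = (\<chi> i j. partial_deriv i (partial_deriv j h) x)"

definition positive_definite :: "real ^ 'n ^ 'n::finite \<Rightarrow> bool" where
  "positive_definite A \<longleftrightarrow> transpose A = A \<and> (\<forall>v. v \<noteq> 0 \<longrightarrow> v \<bullet> (A *v v) > 0)"

end

theory Submission
  imports Defs "HOL-Computational_Algebra.Polynomial"
begin

text \<open>Complementarity gives \<open>L(x\<^sup>*, \<lambda>\<^sup>*) = f(x\<^sup>*)\<close>. Put \<open>h = L(\<cdot>, \<lambda>\<^sup>*) - f(x\<^sup>*)\<close> and \<open>d = c - f(x\<^sup>*)\<close>. Since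
  \<open>d - h = (c - f) + \<Sum> \<lambda>\<^sup>*\<^sub>i (-g\<^sub>i)\<close> and \<open>f - f(x\<^sup>*) = h + \<Sum> \<lambda>\<^sup>*\<^sub>i (-g\<^sub>i)\<close>, it suffices to show that \<open>h\<close> lies in
  \<open>T = \<Sigma>\<^sup>2 + \<Sigma>\<^sup>2 (d - h)\<close>, which is closed under products.

  Translate \<open>x\<^sup>*\<close> to \<open>0\<close>. Integrating the Hessian twice along segments gives \<open>h(x) = x\<^sup>T F(x) x\<close> with \<open>F\<close>
  positive definite everywhere. If \<open>T\<close> contains \<open>R - x\<^sub>i\<close> and \<open>R + x\<^sub>i\<close>, the Bernstein coefficients of \<open>F\<close> on
  the box are positive definite matrices for large degree, which puts \<open>h\<close> into \<open>T\<close>.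

  That \<open>T\<close> is archimedean needs no Positivstellensatz: a convex polynomial has, in suitable linear coordinates,
  a weighted homogeneous leading form which is positive definite. If no bound on \<open>\<rho> = \<Sum> x\<^sub>i ^ K\<^sub>i\<close> were in \<open>T\<close>,
  Zorn's lemma would give an ordering of the polynomial ring extending \<open>T\<close> in which \<open>\<rho>\<close> is infinitely large, hence
  also \<open>h\<close>, contradicting \<open>d - h \<ge> 0\<close>.\<close>


subsection \<open>Evaluation and substitution\<close>

text \<open>Two obstacles shape the proof. First, \<open>h\<close> vanishes at the minimiser, so
  certificates for strictly positive polynomials do not apply to it. Positivity is therefore moved
  from the scalar \<open>h\<close> to the matrix \<open>F\<close>, which has no degenerate point:
  every segment average starts at the minimiser, so one definite Hessian there makes all of them
  definite. Second, the ordinary top-degree form says too little about growth. In x^2 + y^2 + y^4 it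
  vanishes on the x-axis, so the variables need weights; in (x - y)^4 + x^2 + y^2 no weights on the
  given axes help, because growth is slow along the diagonal, so the basis must be changed too.
  Convexity enters the growth estimate twice: Jensen's inequality bounds the weights of mixed
  monomials, and shrinking towards the minimiser excludes zeros of the leading form.\<close>

definition monom_eval :: "('n::finite \<Rightarrow>\<^sub>0 nat) \<Rightarrow> real ^ 'n \<Rightarrow> real" where
  "monom_eval \<alpha> x = (\<Prod>i\<in>UNIV. (x $ i) ^ Poly_Mapping.lookup \<alpha> i)"

definition mpoly_var :: "'n \<Rightarrow> 'n real_mpoly" where
  "mpoly_var i = Poly_Mapping.single (Poly_Mapping.single i 1) 1"

lemma mpoly_eval_eq: "mpoly_eval p x = (\<Sum>\<alpha>\<in>Poly_Mapping.keys p. Poly_Mapping.lookup p \<alpha> * monom_eval \<alpha> x)"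
  by (simp add: mpoly_eval_def monom_eval_def)

lemma mpoly_eval_superset:
  assumes "finite A" "Poly_Mapping.keys p \<subseteq> A"
  shows "mpoly_eval p x = (\<Sum>\<alpha>\<in>A. Poly_Mapping.lookup p \<alpha> * monom_eval \<alpha> x)"
  unfolding mpoly_eval_eq
  by (rule sum.mono_neutral_left) (use assms in \<open>auto simp: in_keys_iff\<close>)

lemma monom_eval_0 [simp]: "monom_eval 0 x = 1"
  by (simp add: monom_eval_def)

lemma monom_eval_add: "monom_eval (\<alpha> + \<beta>) x = monom_eval \<alpha> x * monom_eval \<beta> x"
  by (simp add: monom_eval_def lookup_add power_add prod.distrib)

lemma monom_eval_single: "monom_eval (Poly_Mapping.single i k) x = (x $ i) ^ k"
proof -
  have "monom_eval (Poly_Mapping.single i k) x = (\<Prod>j\<in>UNIV. if j = i then (x $ i) ^ k else 1)"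
    unfolding monom_eval_def by (rule prod.cong) (auto simp: lookup_single when_def)
  then show ?thesis by simp
qed

lemma mpoly_eval_0 [simp]: "mpoly_eval 0 x = 0"
  by (simp add: mpoly_eval_def)

lemma mpoly_eval_single [simp]: "mpoly_eval (Poly_Mapping.single \<alpha> c) x = c * monom_eval \<alpha> x"
  by (simp add: mpoly_eval_eq)

lemma mpoly_eval_const [simp]: "mpoly_eval (mpoly_const c) x = c"
  by (simp add: mpoly_const_def)

lemma mpoly_eval_var [simp]: "mpoly_eval (mpoly_var i) x = x $ i"
  by (simp add: mpoly_var_def monom_eval_single)

lemma mpoly_eval_add [simp]: "mpoly_eval (p + q) x = mpoly_eval p x + mpoly_eval q x"
proof -
  let ?A = "Poly_Mapping.keys p \<union> Poly_Mapping.keys q"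
  show ?thesis
    using mpoly_eval_superset[of ?A p x] mpoly_eval_superset[of ?A q x]
      mpoly_eval_superset[of ?A "p + q" x] keys_add[of p q]
    by (simp add: lookup_add algebra_simps sum.distrib)
qed

lemma mpoly_eval_uminus [simp]: "mpoly_eval (- p) x = - mpoly_eval p x"
  using mpoly_eval_add[of p "- p" x] by simp

lemma mpoly_eval_diff [simp]: "mpoly_eval (p - q) x = mpoly_eval p x - mpoly_eval q x"
  using mpoly_eval_add[of "p - q" q x] by simp

lemma mpoly_eval_sum [simp]: "mpoly_eval (\<Sum>i\<in>I. p i) x = (\<Sum>i\<in>I. mpoly_eval (p i) x)"
  by (induction I rule: infinite_finite_induct) auto

lemma mpoly_sum_monomials:
  "p = (\<Sum>\<alpha>\<in>Poly_Mapping.keys p. Poly_Mapping.single \<alpha> (Poly_Mapping.lookup p \<alpha>))"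
  by (rule poly_mapping_eqI)
     (auto simp: lookup_sum lookup_single when_def in_keys_iff)

lemma mpoly_eval_mult [simp]: "mpoly_eval (p * q) x = mpoly_eval p x * mpoly_eval q x"
proof -
  have "p * q = (\<Sum>\<alpha>\<in>Poly_Mapping.keys p. Poly_Mapping.single \<alpha> (Poly_Mapping.lookup p \<alpha>)) *
      (\<Sum>\<beta>\<in>Poly_Mapping.keys q. Poly_Mapping.single \<beta> (Poly_Mapping.lookup q \<beta>))"
    using mpoly_sum_monomials[of p] mpoly_sum_monomials[of q] by argo
  also have "\<dots> = (\<Sum>\<alpha>\<in>Poly_Mapping.keys p. \<Sum>\<beta>\<in>Poly_Mapping.keys q.
      Poly_Mapping.single (\<alpha> + \<beta>) (Poly_Mapping.lookup p \<alpha> * Poly_Mapping.lookup q \<beta>))"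
    by (simp only: sum_product mult_single)
  finally have "mpoly_eval (p * q) x = (\<Sum>\<alpha>\<in>Poly_Mapping.keys p. \<Sum>\<beta>\<in>Poly_Mapping.keys q.
      (Poly_Mapping.lookup p \<alpha> * Poly_Mapping.lookup q \<beta>) * (monom_eval \<alpha> x * monom_eval \<beta> x))"
    by (simp only: mpoly_eval_sum mpoly_eval_single monom_eval_add)
  also have "\<dots> = mpoly_eval p x * mpoly_eval q x"
    by (simp only: mpoly_eval_eq sum_product mult_ac)
  finally show ?thesis .
qed

lemma mpoly_eval_1 [simp]: "mpoly_eval 1 x = 1"
  using mpoly_eval_const[of 1 x] by (simp add: mpoly_const_def)

lemma mpoly_eval_of_nat [simp]: "mpoly_eval (of_nat k) x = of_nat k"
  by (induction k) auto

lemma mpoly_eval_numeral [simp]: "mpoly_eval (numeral k) x = numeral k"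
  using mpoly_eval_of_nat[of "numeral k" x] by simp

lemma mpoly_eval_power [simp]: "mpoly_eval (p ^ k) x = mpoly_eval p x ^ k"
  by (induction k) auto

lemma mpoly_eval_prod [simp]: "mpoly_eval (\<Prod>i\<in>I. p i) x = (\<Prod>i\<in>I. mpoly_eval (p i) x)"
  by (induction I rule: infinite_finite_induct) auto

text \<open>The variables are separated one at a time: \<open>?A V\<close> keeps the exponents that
  agree with \<open>\<beta>\<close> on \<open>V\<close>, and for \<open>V = UNIV\<close> only
  \<open>\<beta>\<close> is left, where evaluation at the all-one vector returns its
  coefficient.\<close>

lemma sum_monom_eval_eq_0_imp:
  fixes c :: "('n::finite \<Rightarrow>\<^sub>0 nat) \<Rightarrow> real"
  assumes "finite A" and zero: "\<And>x. (\<Sum>\<alpha>\<in>A. c \<alpha> * monom_eval \<alpha> x) = 0" and "\<beta> \<in> A"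
  shows "c \<beta> = 0"
proof -
  let ?A = "\<lambda>V. {\<alpha>\<in>A. \<forall>i\<in>V. Poly_Mapping.lookup \<alpha> i = Poly_Mapping.lookup \<beta> i}"
  have fin: "finite (?A V)" for V
    using assms(1) by simp
  have "(\<Sum>\<alpha>\<in>?A V. c \<alpha> * monom_eval \<alpha> x) = 0" if "finite V" for V and x :: "real ^ 'n"
    using that
  proof (induction V arbitrary: x rule: finite_induct)
    case empty
    then show ?case using zero by simp
  next
    case (insert i V)
    \<comment> \<open>As a polynomial in \<open>x\<^sub>i\<close> alone, the sum over \<open>V\<close> vanishes, hence so does each coefficient.\<close>
    let ?r = "\<lambda>\<alpha>. c \<alpha> * (\<Prod>j\<in>UNIV-{i}. (x $ j) ^ Poly_Mapping.lookup \<alpha> j)"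
    define P where "P = (\<Sum>\<alpha>\<in>?A V. monom (?r \<alpha>) (Poly_Mapping.lookup \<alpha> i))"
    have ev: "monom_eval \<alpha> (\<chi> j. if j = i then t else x $ j) =
        t ^ Poly_Mapping.lookup \<alpha> i * (\<Prod>j\<in>UNIV-{i}. (x $ j) ^ Poly_Mapping.lookup \<alpha> j)" for \<alpha> t
      unfolding monom_eval_def by (subst prod.remove[of _ i]) auto
    have "poly P t = 0" for t
      using insert.IH[of "\<chi> j. if j = i then t else x $ j"]
      by (simp add: P_def poly_sum poly_monom ev algebra_simps)
    then have "P = 0" using poly_all_0_iff_0[of P] by simp
    then have "0 = coeff P (Poly_Mapping.lookup \<beta> i)" by simp
    also have "\<dots> = (\<Sum>\<alpha>\<in>?A V. if Poly_Mapping.lookup \<alpha> i = Poly_Mapping.lookup \<beta> i then ?r \<alpha> else 0)"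
      by (simp add: P_def coeff_sum)
    also have "\<dots> = (\<Sum>\<alpha>\<in>?A (insert i V). ?r \<alpha>)"
      using fin[of V] by (subst sum.inter_filter[symmetric]) (auto intro!: sum.cong)
    finally have *: "(\<Sum>\<alpha>\<in>?A (insert i V). ?r \<alpha>) = 0" by simp
    have "(\<Sum>\<alpha>\<in>?A (insert i V). c \<alpha> * monom_eval \<alpha> x) =
        (\<Sum>\<alpha>\<in>?A (insert i V). (x $ i) ^ Poly_Mapping.lookup \<beta> i * ?r \<alpha>)"
      unfolding monom_eval_def by (intro sum.cong refl) (subst prod.remove[of _ i], auto)
    also have "\<dots> = 0"
      by (simp only: sum_distrib_left[symmetric] * mult_zero_right)
    finally show ?case .
  qed
  from this[of UNIV "\<chi> i. 1"] have "(\<Sum>\<alpha>\<in>?A UNIV. c \<alpha> * monom_eval \<alpha> (\<chi> i. 1)) = 0" by simp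
  moreover have "?A UNIV = {\<beta>}" using \<open>\<beta> \<in> A\<close> by (auto intro: poly_mapping_eqI)
  ultimately show ?thesis by (simp add: monom_eval_def)
qed

text \<open>Lets ring identities below be proved by evaluation, that is, by arithmetic in the
  reals.\<close>

lemma mpoly_eval_inject:
  fixes p q :: "'n::finite real_mpoly"
  assumes "\<And>x. mpoly_eval p x = mpoly_eval q x"
  shows "p = q"
proof -
  have "Poly_Mapping.lookup (p - q) \<beta> = 0" for \<beta>
  proof (cases "\<beta> \<in> Poly_Mapping.keys (p - q)")
    case True
    show ?thesis
      by (rule sum_monom_eval_eq_0_imp[OF finite_keys _ True])
         (use assms in \<open>simp flip: mpoly_eval_eq\<close>)
  qed (simp add: in_keys_iff)
  then show ?thesis by (intro poly_mapping_eqI) (simp add: lookup_minus)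
qed

lemma mpoly_const_add: "mpoly_const (a + b) = (mpoly_const a + mpoly_const b :: 'n::finite real_mpoly)"
  by (rule mpoly_eval_inject) simp

lemma mpoly_const_diff: "mpoly_const (a - b) = (mpoly_const a - mpoly_const b :: 'n::finite real_mpoly)"
  by (rule mpoly_eval_inject) simp

lemma mpoly_const_minus: "mpoly_const (- a) = (- mpoly_const a :: 'n::finite real_mpoly)"
  by (rule mpoly_eval_inject) simp

lemma mpoly_const_0: "mpoly_const 0 = (0 :: 'n::finite real_mpoly)"
  by (rule mpoly_eval_inject) simp

lemma mpoly_const_1: "mpoly_const 1 = (1 :: 'n::finite real_mpoly)"
  by (rule mpoly_eval_inject) simp

definition mpoly_subst :: "('n::finite \<Rightarrow> 'k real_mpoly) \<Rightarrow> 'n real_mpoly \<Rightarrow> 'k real_mpoly" where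
  "mpoly_subst \<theta> p = (\<Sum>\<alpha>\<in>Poly_Mapping.keys p.
     mpoly_const (Poly_Mapping.lookup p \<alpha>) * (\<Prod>i\<in>UNIV. \<theta> i ^ Poly_Mapping.lookup \<alpha> i))"

lemma mpoly_eval_subst [simp]:
  "mpoly_eval (mpoly_subst \<theta> p) x = mpoly_eval p (\<chi> i. mpoly_eval (\<theta> i) x)"
  by (simp add: mpoly_subst_def mpoly_eval_def[of p])

lemma mpoly_subst_var: "mpoly_subst mpoly_var p = (p :: 'n::finite real_mpoly)"
  by (rule mpoly_eval_inject) simp

subsection \<open>Derivatives\<close>

text \<open>Exponent subtraction is truncated; when variable \<open>i\<close> does not occur in
  \<open>\<alpha>\<close>, the coefficient of the resulting term is 0.\<close>

definition mpoly_deriv :: "'n \<Rightarrow> 'n real_mpoly \<Rightarrow> 'n real_mpoly" where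
  "mpoly_deriv i p = (\<Sum>\<alpha>\<in>Poly_Mapping.keys p.
     Poly_Mapping.single (\<alpha> - Poly_Mapping.single i 1)
       (Poly_Mapping.lookup p \<alpha> * real (Poly_Mapping.lookup \<alpha> i)))"

definition monom_deriv :: "'n \<Rightarrow> ('n::finite \<Rightarrow>\<^sub>0 nat) \<Rightarrow> real ^ 'n \<Rightarrow> real" where
  "monom_deriv i \<alpha> x = real (Poly_Mapping.lookup \<alpha> i) * monom_eval (\<alpha> - Poly_Mapping.single i 1) x"

lemma mpoly_eval_deriv:
  "mpoly_eval (mpoly_deriv i p) x = (\<Sum>\<alpha>\<in>Poly_Mapping.keys p. Poly_Mapping.lookup p \<alpha> * monom_deriv i \<alpha> x)"
  by (simp add: mpoly_deriv_def monom_deriv_def algebra_simps)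

lemma monom_has_derivative:
  "(monom_eval \<alpha> has_derivative (\<lambda>v. \<Sum>i\<in>UNIV. v $ i * monom_deriv i \<alpha> x)) (at x)"
proof -
  have eq: "monom_eval (\<alpha> - Poly_Mapping.single i 1) x =
      (x $ i) ^ (Poly_Mapping.lookup \<alpha> i - 1) * (\<Prod>j\<in>UNIV-{i}. (x $ j) ^ Poly_Mapping.lookup \<alpha> j)" for i
    unfolding monom_eval_def
    by (subst prod.remove[of _ i]) (auto simp: lookup_minus lookup_single intro!: prod.cong)
  have "((\<lambda>x. \<Prod>i\<in>UNIV. (x $ i) ^ Poly_Mapping.lookup \<alpha> i) has_derivative
     (\<lambda>v. \<Sum>i\<in>UNIV. (of_nat (Poly_Mapping.lookup \<alpha> i) * v $ i * (x $ i) ^ (Poly_Mapping.lookup \<alpha> i - 1)) *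
        (\<Prod>j\<in>UNIV-{i}. (x $ j) ^ Poly_Mapping.lookup \<alpha> j))) (at x)"
    by (intro has_derivative_prod has_derivative_power bounded_linear_imp_has_derivative
        bounded_linear_vec_nth)
  moreover have "(\<Sum>i\<in>UNIV. (of_nat (Poly_Mapping.lookup \<alpha> i) * v $ i * (x $ i) ^ (Poly_Mapping.lookup \<alpha> i - 1)) *
        (\<Prod>j\<in>UNIV-{i}. (x $ j) ^ Poly_Mapping.lookup \<alpha> j)) = (\<Sum>i\<in>UNIV. v $ i * monom_deriv i \<alpha> x)" for v
    unfolding monom_deriv_def eq by (simp add: mult_ac)
  ultimately show ?thesis
    unfolding monom_eval_def[abs_def] by (simp only:)
qed

lemma mpoly_has_derivative:
  "(mpoly_eval p has_derivative (\<lambda>v. \<Sum>i\<in>UNIV. v $ i * mpoly_eval (mpoly_deriv i p) x)) (at x)"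
proof -
  have "((\<lambda>x. \<Sum>\<alpha>\<in>Poly_Mapping.keys p. Poly_Mapping.lookup p \<alpha> * monom_eval \<alpha> x) has_derivative
     (\<lambda>v. \<Sum>\<alpha>\<in>Poly_Mapping.keys p. Poly_Mapping.lookup p \<alpha> * (\<Sum>i\<in>UNIV. v $ i * monom_deriv i \<alpha> x))) (at x)"
    by (intro has_derivative_sum has_derivative_mult_right monom_has_derivative)
  moreover have "(\<Sum>\<alpha>\<in>Poly_Mapping.keys p. Poly_Mapping.lookup p \<alpha> * (\<Sum>i\<in>UNIV. v $ i * monom_deriv i \<alpha> x)) =
     (\<Sum>i\<in>UNIV. v $ i * mpoly_eval (mpoly_deriv i p) x)" for v
    by (simp add: mpoly_eval_deriv sum_distrib_left algebra_simps) (rule sum.swap)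
  ultimately show ?thesis
    by (simp add: mpoly_eval_eq[abs_def])
qed

lemma continuous_on_mpoly_eval: "continuous_on S (mpoly_eval p)"
  by (meson continuous_at_imp_continuous_on has_derivative_continuous mpoly_has_derivative)

lemma partial_deriv_mpoly: "partial_deriv i (mpoly_eval p) x = mpoly_eval (mpoly_deriv i p) x"
proof -
  have "frechet_derivative (mpoly_eval p) (at x) = (\<lambda>v. \<Sum>i\<in>UNIV. v $ i * mpoly_eval (mpoly_deriv i p) x)"
    by (rule frechet_derivative_at[OF mpoly_has_derivative, symmetric])
  then show ?thesis
    by (simp add: partial_deriv_def axis_def if_distrib[where f = "\<lambda>z. z * _"] cong: if_cong)
qed

lemma hessian_mpoly:
  "hessian (mpoly_eval p) x = (\<chi> i j. mpoly_eval (mpoly_deriv i (mpoly_deriv j p)) x)"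
  by (simp add: hessian_def partial_deriv_mpoly[abs_def])

lemma mpoly_line_has_derivative:
  "((\<lambda>t. mpoly_eval p (x + t *\<^sub>R v)) has_real_derivative
     (\<Sum>i\<in>UNIV. v $ i * mpoly_eval (mpoly_deriv i p) (x + t *\<^sub>R v))) (at t)"
proof -
  have "((\<lambda>t. x + t *\<^sub>R v) has_derivative (\<lambda>s. s *\<^sub>R v)) (at t)"
    by (auto intro!: derivative_eq_intros)
  from has_derivative_compose[OF this mpoly_has_derivative[of p]]
  show ?thesis
    unfolding has_field_derivative_def
    by (rule has_derivative_eq_rhs) (simp add: fun_eq_iff sum_distrib_left mult_ac)
qed

definition mpoly_hess :: "'n::finite real_mpoly \<Rightarrow> real ^ 'n \<Rightarrow> real ^ 'n \<Rightarrow> real" where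
  "mpoly_hess p x v = (\<Sum>i\<in>UNIV. \<Sum>j\<in>UNIV. v $ i * v $ j * mpoly_eval (mpoly_deriv i (mpoly_deriv j p)) x)"

lemma mpoly_line_has_derivative2:
  "((\<lambda>t. \<Sum>j\<in>UNIV. v $ j * mpoly_eval (mpoly_deriv j p) (x + t *\<^sub>R v)) has_real_derivative
     mpoly_hess p (x + t *\<^sub>R v) v) (at t)"
proof -
  have "((\<lambda>t. \<Sum>j\<in>UNIV. v $ j * mpoly_eval (mpoly_deriv j p) (x + t *\<^sub>R v)) has_real_derivative
     (\<Sum>j\<in>UNIV. v $ j * (\<Sum>i\<in>UNIV. v $ i * mpoly_eval (mpoly_deriv i (mpoly_deriv j p)) (x + t *\<^sub>R v)))) (at t)"
    by (intro derivative_intros DERIV_cmult mpoly_line_has_derivative)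
  then show ?thesis
    unfolding mpoly_hess_def by (subst sum.swap) (simp add: sum_distrib_left algebra_simps)
qed

text \<open>On the line through \<open>x\<close> in direction \<open>v\<close>, adding the tangent
  inequalities at two points shows that the slope is monotone; the Hessian form is the derivative of
  this slope.\<close>

lemma mpoly_hess_nonneg:
  assumes "convex_on UNIV (mpoly_eval p)"
  shows "mpoly_hess p x v \<ge> 0"
proof -
  define \<phi> where "\<phi> = (\<lambda>t. mpoly_eval p (x + t *\<^sub>R v))"
  define \<phi>' where "\<phi>' = (\<lambda>t. \<Sum>j\<in>UNIV. v $ j * mpoly_eval (mpoly_deriv j p) (x + t *\<^sub>R v))"
  have d: "(\<phi> has_real_derivative \<phi>' t) (at t)" for t
    unfolding \<phi>_def \<phi>'_def by (rule mpoly_line_has_derivative)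
  have "convex_on UNIV \<phi>"
  proof (intro convex_onI)
    fix t a b :: real assume "0 < t" "t < 1"
    have "x + ((1 - t) *\<^sub>R a + t *\<^sub>R b) *\<^sub>R v = (1 - t) *\<^sub>R (x + a *\<^sub>R v) + t *\<^sub>R (x + b *\<^sub>R v)"
      by (simp add: algebra_simps)
    with convex_onD[OF assms, of t "x + a *\<^sub>R v" "x + b *\<^sub>R v"] \<open>0 < t\<close> \<open>t < 1\<close>
    show "\<phi> ((1 - t) *\<^sub>R a + t *\<^sub>R b) \<le> (1 - t) * \<phi> a + t * \<phi> b"
      by (simp add: \<phi>_def)
  qed simp
  then have tangent: "\<phi> b - \<phi> a \<ge> \<phi>' a * (b - a)" for a b
    by (rule convex_on_imp_above_tangent[where A = UNIV]) (auto intro: has_field_derivative_at_within d)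
  have "mono \<phi>'"
  proof (rule monoI)
    fix a b :: real assume "a \<le> b"
    have "(\<phi>' b - \<phi>' a) * (b - a) \<ge> 0"
      using tangent[of b a] tangent[of a b] by (simp add: algebra_simps)
    with \<open>a \<le> b\<close> show "\<phi>' a \<le> \<phi>' b"
      by (cases "a = b") (auto simp: zero_le_mult_iff)
  qed
  moreover have "(\<phi>' has_real_derivative mpoly_hess p x v) (at 0)"
    using mpoly_line_has_derivative2[of v p x 0] by (simp add: \<phi>'_def)
  ultimately show ?thesis
    using mono_on_imp_deriv_nonneg[of UNIV \<phi>' "mpoly_hess p x v" 0] by simp
qed

section \<open>Degrees, homogeneity and Euler's relation for the Hessian\<close>

definition monom_degree :: "('n::finite \<Rightarrow>\<^sub>0 nat) \<Rightarrow> nat" where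
  "monom_degree \<alpha> = (\<Sum>i\<in>UNIV. Poly_Mapping.lookup \<alpha> i)"

lemma monom_degree_add: "monom_degree (\<alpha> + \<beta>) = monom_degree \<alpha> + monom_degree \<beta>"
  by (simp add: monom_degree_def lookup_add sum.distrib)

lemma monom_degree_single [simp]: "monom_degree (Poly_Mapping.single i k) = k"
  by (simp add: monom_degree_def lookup_single when_def)

lemma monom_degree_0 [simp]: "monom_degree 0 = 0"
  by (simp add: monom_degree_def)

lemma monom_degree_eq_0_iff [simp]: "monom_degree \<alpha> = 0 \<longleftrightarrow> \<alpha> = 0"
  by (auto simp: monom_degree_def intro: poly_mapping_eqI)

lemma minus_single_add:
  assumes "Poly_Mapping.lookup \<alpha> i \<noteq> 0"
  shows "\<alpha> - Poly_Mapping.single i 1 + Poly_Mapping.single i 1 = (\<alpha> :: 'n \<Rightarrow>\<^sub>0 nat)"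
  by (rule poly_mapping_eqI) (use assms in \<open>auto simp: lookup_add lookup_minus lookup_single when_def\<close>)

lemma monom_degree_minus_single:
  assumes "Poly_Mapping.lookup \<alpha> i \<noteq> 0"
  shows "monom_degree \<alpha> = Suc (monom_degree (\<alpha> - Poly_Mapping.single i 1))"
  using arg_cong[OF minus_single_add[OF assms], of monom_degree] by (simp add: monom_degree_add)

lemma monom_eval_minus_single:
  assumes "Poly_Mapping.lookup \<alpha> i \<noteq> 0"
  shows "monom_eval \<alpha> x = x $ i * monom_eval (\<alpha> - Poly_Mapping.single i 1) x"
  using arg_cong[OF minus_single_add[OF assms], of "\<lambda>\<alpha>. monom_eval \<alpha> x"]
  by (simp add: monom_eval_add monom_eval_single mult.commute)

lemma monom_eval_scaleR: "monom_eval \<alpha> (t *\<^sub>R x) = t ^ monom_degree \<alpha> * monom_eval \<alpha> x"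
  by (simp add: monom_eval_def monom_degree_def power_mult_distrib prod.distrib power_sum)

lemma monom_eval_at_0: "monom_eval \<alpha> 0 = (if \<alpha> = 0 then 1 else 0)"
  using monom_eval_scaleR[of \<alpha> 0 0] by (auto simp: power_0_left)

lemma mpoly_eval_deriv_superset:
  assumes "finite A" "Poly_Mapping.keys p \<subseteq> A"
  shows "mpoly_eval (mpoly_deriv i p) x = (\<Sum>\<alpha>\<in>A. Poly_Mapping.lookup p \<alpha> * monom_deriv i \<alpha> x)"
  unfolding mpoly_eval_deriv
  by (rule sum.mono_neutral_left) (use assms in \<open>auto simp: in_keys_iff\<close>)

lemma mpoly_deriv_add:
  "mpoly_deriv i (p + q) = mpoly_deriv i p + mpoly_deriv i (q :: 'n::finite real_mpoly)"
proof (rule mpoly_eval_inject)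
  fix x
  let ?A = "Poly_Mapping.keys p \<union> Poly_Mapping.keys q"
  show "mpoly_eval (mpoly_deriv i (p + q)) x = mpoly_eval (mpoly_deriv i p + mpoly_deriv i q) x"
    using mpoly_eval_deriv_superset[of ?A p i x] mpoly_eval_deriv_superset[of ?A q i x]
      mpoly_eval_deriv_superset[of ?A "p + q" i x] keys_add[of p q]
    by (simp add: lookup_add algebra_simps sum.distrib)
qed

lemma mpoly_deriv_0 [simp]: "mpoly_deriv i 0 = 0"
  by (simp add: mpoly_deriv_def)

lemma mpoly_deriv_sum:
  "mpoly_deriv i (\<Sum>a\<in>A. p a) = (\<Sum>a\<in>A. mpoly_deriv i (p a :: 'n::finite real_mpoly))"
  by (induction A rule: infinite_finite_induct) (auto simp: mpoly_deriv_add)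

lemma mpoly_deriv_single:
  "mpoly_deriv i (Poly_Mapping.single \<alpha> c) =
     Poly_Mapping.single (\<alpha> - Poly_Mapping.single i 1) (c * real (Poly_Mapping.lookup \<alpha> i))"
  by (simp add: mpoly_deriv_def)

text \<open>The Hessian form of one monomial. Looking up \<open>i\<close> after removing one factor
  \<open>j\<close> gives the exponent of \<open>i\<close> off the diagonal and that exponent minus 1
  on it, so one formula covers pure and mixed second derivatives.\<close>

definition monom_hess :: "('n::finite \<Rightarrow>\<^sub>0 nat) \<Rightarrow> real ^ 'n \<Rightarrow> real ^ 'n \<Rightarrow> real" where
  "monom_hess \<alpha> x v = (\<Sum>i\<in>UNIV. \<Sum>j\<in>UNIV. v $ i * v $ j *
     (real (Poly_Mapping.lookup \<alpha> j) * real (Poly_Mapping.lookup (\<alpha> - Poly_Mapping.single j 1) i) *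
      monom_eval (\<alpha> - Poly_Mapping.single j 1 - Poly_Mapping.single i 1) x))"

lemma mpoly_hess_eq_superset:
  assumes "finite A" "Poly_Mapping.keys p \<subseteq> A"
  shows "mpoly_hess p x v = (\<Sum>\<alpha>\<in>A. Poly_Mapping.lookup p \<alpha> * monom_hess \<alpha> x v)"
proof -
  have "mpoly_eval (mpoly_deriv i (mpoly_deriv j p)) x = (\<Sum>\<alpha>\<in>Poly_Mapping.keys p. Poly_Mapping.lookup p \<alpha> *
     (real (Poly_Mapping.lookup \<alpha> j) * real (Poly_Mapping.lookup (\<alpha> - Poly_Mapping.single j 1) i) *
      monom_eval (\<alpha> - Poly_Mapping.single j 1 - Poly_Mapping.single i 1) x))" for i j
    unfolding mpoly_deriv_def[of j p] mpoly_deriv_sum mpoly_deriv_single by (simp add: mult_ac)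
  then have "mpoly_hess p x v = (\<Sum>i\<in>UNIV. \<Sum>j\<in>UNIV. \<Sum>\<alpha>\<in>Poly_Mapping.keys p.
     Poly_Mapping.lookup p \<alpha> * (v $ i * v $ j *
     (real (Poly_Mapping.lookup \<alpha> j) * real (Poly_Mapping.lookup (\<alpha> - Poly_Mapping.single j 1) i) *
      monom_eval (\<alpha> - Poly_Mapping.single j 1 - Poly_Mapping.single i 1) x)))"
    by (simp add: mpoly_hess_def sum_distrib_left mult_ac)
  also have "\<dots> = (\<Sum>i\<in>UNIV. \<Sum>\<alpha>\<in>Poly_Mapping.keys p. \<Sum>j\<in>UNIV.
     Poly_Mapping.lookup p \<alpha> * (v $ i * v $ j *
     (real (Poly_Mapping.lookup \<alpha> j) * real (Poly_Mapping.lookup (\<alpha> - Poly_Mapping.single j 1) i) *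
      monom_eval (\<alpha> - Poly_Mapping.single j 1 - Poly_Mapping.single i 1) x)))"
    by (intro sum.cong refl sum.swap)
  also have "\<dots> = (\<Sum>\<alpha>\<in>Poly_Mapping.keys p. Poly_Mapping.lookup p \<alpha> * monom_hess \<alpha> x v)"
    unfolding monom_hess_def sum_distrib_left by (rule sum.swap)
  also have "\<dots> = (\<Sum>\<alpha>\<in>A. Poly_Mapping.lookup p \<alpha> * monom_hess \<alpha> x v)"
    by (rule sum.mono_neutral_left) (use assms in \<open>auto simp: in_keys_iff\<close>)
  finally show ?thesis .
qed

text \<open>Second derivatives are homogeneous of degree two less. Below degree 2 the truncated
  difference does no harm, as all coefficients \<open>?c i j\<close> vanish.\<close>

lemma monom_hess_scaleR: "monom_hess \<alpha> (t *\<^sub>R x) v = t ^ (monom_degree \<alpha> - 2) * monom_hess \<alpha> x v"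
proof -
  let ?c = "\<lambda>i j. real (Poly_Mapping.lookup \<alpha> j) * real (Poly_Mapping.lookup (\<alpha> - Poly_Mapping.single j 1) i)"
  let ?\<beta> = "\<lambda>i j. \<alpha> - Poly_Mapping.single j 1 - Poly_Mapping.single i 1"
  have "?c i j * monom_eval (?\<beta> i j) (t *\<^sub>R x) = t ^ (monom_degree \<alpha> - 2) * (?c i j * monom_eval (?\<beta> i j) x)" for i j
  proof (cases "?c i j = 0")
    case False
    then have "monom_degree \<alpha> - 2 = monom_degree (?\<beta> i j)"
      using monom_degree_minus_single[of \<alpha> j] monom_degree_minus_single[of "\<alpha> - Poly_Mapping.single j 1" i]
      by simp
    then show ?thesis by (simp add: monom_eval_scaleR)
  qed (simp only: mult_zero_left mult_zero_right)
  then show ?thesis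
    unfolding monom_hess_def sum_distrib_left by (intro sum.cong refl) (simp add: mult_ac)
qed

text \<open>Euler's relation used twice: each second-order term restores the monomial, and the
  multiplicities add up to n(n-1) for degree n.\<close>

lemma monom_hess_euler:
  "monom_hess \<alpha> x x = real (monom_degree \<alpha>) * (real (monom_degree \<alpha>) - 1) * monom_eval \<alpha> x"
proof -
  let ?c = "\<lambda>i j. real (Poly_Mapping.lookup \<alpha> j) * real (Poly_Mapping.lookup (\<alpha> - Poly_Mapping.single j 1) i)"
  let ?\<beta> = "\<lambda>i j. \<alpha> - Poly_Mapping.single j 1 - Poly_Mapping.single i 1"
  have *: "x $ i * x $ j * (?c i j * monom_eval (?\<beta> i j) x) = ?c i j * monom_eval \<alpha> x" for i j
  proof (cases "?c i j = 0")
    case False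
    then show ?thesis
      using monom_eval_minus_single[of \<alpha> j x] monom_eval_minus_single[of "\<alpha> - Poly_Mapping.single j 1" i x]
      by simp
  qed (simp only: mult_zero_left mult_zero_right)
  have "monom_hess \<alpha> x x = (\<Sum>i\<in>UNIV. \<Sum>j\<in>UNIV. ?c i j) * monom_eval \<alpha> x"
    by (simp only: monom_hess_def sum_distrib_right *)
  moreover have "(\<Sum>i\<in>UNIV. \<Sum>j\<in>UNIV. ?c i j) = (\<Sum>j\<in>UNIV. real (Poly_Mapping.lookup \<alpha> j) * (real (monom_degree \<alpha>) - 1))"
  proof (subst sum.swap, rule sum.cong[OF refl])
    fix j
    have "real (Poly_Mapping.lookup \<alpha> j) * real (monom_degree (\<alpha> - Poly_Mapping.single j 1)) =
        real (Poly_Mapping.lookup \<alpha> j) * (real (monom_degree \<alpha>) - 1)"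
      using monom_degree_minus_single[of \<alpha> j] by (cases "Poly_Mapping.lookup \<alpha> j = 0") auto
    then show "(\<Sum>i\<in>UNIV. ?c i j) = real (Poly_Mapping.lookup \<alpha> j) * (real (monom_degree \<alpha>) - 1)"
      by (simp add: monom_degree_def sum_distrib_left)
  qed
  ultimately show ?thesis
    by (simp add: sum_distrib_right[symmetric] monom_degree_def)
qed

text \<open>Although \<open>\<Psi>\<close> may vanish away from 0, \<open>\<Phi>'\<close> rises
  strictly just after 0 and never falls again, so it is positive on the whole positive axis.\<close>

lemma integrated_nonneg_pos:
  fixes \<Phi> \<Phi>' \<Psi> :: "real \<Rightarrow> real"
  assumes d1: "\<And>t. (\<Phi> has_real_derivative \<Phi>' t) (at t)"
    and d2: "\<And>t. (\<Phi>' has_real_derivative \<Psi> t) (at t)"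
    and "\<Phi> 0 = 0" "\<Phi>' 0 = 0" "\<And>t. \<Psi> t \<ge> 0" "\<Psi> 0 > 0"
  shows "\<Phi> 1 > 0"
proof -
  have mono: "\<Phi>' a \<le> \<Phi>' b" if "a \<le> b" for a b
    by (rule DERIV_nonneg_imp_nondecreasing[OF that]) (use assms in blast)
  obtain \<delta> where \<delta>: "\<delta> > 0" "\<And>t. 0 < t \<Longrightarrow> t < \<delta> \<Longrightarrow> \<Phi>' 0 < \<Phi>' (0 + t)"
    using DERIV_pos_inc_right[OF d2[of 0] \<open>\<Psi> 0 > 0\<close>] by blast
  have pos: "\<Phi>' t > 0" if "t > 0" for t
  proof -
    \<comment> \<open>A point inside the range of strict increase and not beyond \<open>t\<close>;
      monotonicity carries positivity from there to \<open>t\<close>.\<close>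
    have "min t (\<delta> / 2) > 0" "min t (\<delta> / 2) < \<delta>" using that \<delta>(1) by auto
    with \<delta>(2)[of "min t (\<delta> / 2)"] mono[of "min t (\<delta> / 2)" t] assms(4) show ?thesis by simp
  qed
  have "\<Phi> 0 < \<Phi> 1"
  proof (rule DERIV_pos_imp_increasing_open[of 0 1 \<Phi>])
    show "\<exists>y. (\<Phi> has_real_derivative y) (at t) \<and> 0 < y" if "0 < t" "t < 1" for t
      using d1[of t] pos[OF that(1)] by blast
    show "continuous_on {0..1} \<Phi>"
      by (rule DERIV_continuous_on) (rule DERIV_subset[OF d1 subset_UNIV])
  qed simp
  with assms show ?thesis by simp
qed

text \<open>Twice integrating the Hessian along the segment from \<open>0\<close> to \<open>x\<close> writes \<open>h(x)\<close> as \<open>x\<^sup>T F(x) x\<close> with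
  \<open>F(x) = \<integral>\<^sub>0\<^sup>1 (1-t) H(tx) dt\<close>, which is positive definite at every \<open>x\<close>. On monomials of degree \<open>n\<close>
  this operation is division of the Hessian by \<open>n(n-1)\<close>.\<close>
lemma convex_quadratic_form_representation:
  fixes h :: "'n::finite real_mpoly"
  assumes deg: "\<And>\<alpha>. \<alpha> \<in> Poly_Mapping.keys h \<Longrightarrow> monom_degree \<alpha> \<ge> 2"
    and conv: "convex_on UNIV (mpoly_eval h)"
    and pd: "\<And>v. v \<noteq> 0 \<Longrightarrow> mpoly_hess h 0 v > 0"
  obtains F where "\<And>x. mpoly_eval h x = (\<Sum>i\<in>UNIV. \<Sum>j\<in>UNIV. x $ i * x $ j * mpoly_eval (F i j) x)"
    and "\<And>x v. v \<noteq> 0 \<Longrightarrow> (\<Sum>i\<in>UNIV. \<Sum>j\<in>UNIV. v $ i * v $ j * mpoly_eval (F i j) x) > 0"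
proof -
  let ?n = "\<lambda>\<alpha>. real (monom_degree \<alpha>)"
  \<comment> \<open>The Hessian of \<open>G\<close> is the wanted \<open>F\<close>: the divisor
    cancels the factor of Euler's relation, and it is nonzero because all degrees are at least
    2.\<close>
  define G where "G = (\<Sum>\<alpha>\<in>Poly_Mapping.keys h.
    Poly_Mapping.single \<alpha> (Poly_Mapping.lookup h \<alpha> / (?n \<alpha> * (?n \<alpha> - 1))))"
  define F where "F = (\<lambda>i j. mpoly_deriv i (mpoly_deriv j G))"
  have lookup_G: "Poly_Mapping.lookup G \<alpha> = Poly_Mapping.lookup h \<alpha> / (?n \<alpha> * (?n \<alpha> - 1))" for \<alpha>
    by (auto simp: G_def lookup_sum lookup_single when_def in_keys_iff)
  have keys_G: "Poly_Mapping.keys G \<subseteq> Poly_Mapping.keys h"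
    by (auto simp: in_keys_iff lookup_G)
  have F: "(\<Sum>i\<in>UNIV. \<Sum>j\<in>UNIV. v $ i * v $ j * mpoly_eval (F i j) x) =
      (\<Sum>\<alpha>\<in>Poly_Mapping.keys h. Poly_Mapping.lookup h \<alpha> / (?n \<alpha> * (?n \<alpha> - 1)) * monom_hess \<alpha> x v)" for x v
    using mpoly_hess_eq_superset[OF finite_keys keys_G, of x v]
    by (simp add: F_def lookup_G mpoly_hess_def)
  show ?thesis
  proof
    fix x :: "real ^ 'n"
    have "Poly_Mapping.lookup h \<alpha> / (?n \<alpha> * (?n \<alpha> - 1)) * monom_hess \<alpha> x x =
        Poly_Mapping.lookup h \<alpha> * monom_eval \<alpha> x" if "\<alpha> \<in> Poly_Mapping.keys h" for \<alpha>
    proof -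
      have "?n \<alpha> \<ge> 2" using deg[OF that] by simp
      then show ?thesis by (auto simp: monom_hess_euler)
    qed
    then show "mpoly_eval h x = (\<Sum>i\<in>UNIV. \<Sum>j\<in>UNIV. x $ i * x $ j * mpoly_eval (F i j) x)"
      unfolding F by (simp add: mpoly_eval_eq)
  next
    fix x v :: "real ^ 'n" assume "v \<noteq> 0"
    \<comment> \<open>\<open>\<Phi> 1\<close> is the form of \<open>F\<close> at \<open>x\<close>,
      and the second derivative of \<open>\<Phi>\<close> is the Hessian form of \<open>h\<close> at
      \<open>t *\<^sub>R x\<close>.\<close>
    define \<Phi> where "\<Phi> = (\<lambda>t. \<Sum>\<alpha>\<in>Poly_Mapping.keys h.
      Poly_Mapping.lookup h \<alpha> * monom_hess \<alpha> x v * (t ^ monom_degree \<alpha> / (?n \<alpha> * (?n \<alpha> - 1))))"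
    define \<Phi>' where "\<Phi>' = (\<lambda>t. \<Sum>\<alpha>\<in>Poly_Mapping.keys h.
      Poly_Mapping.lookup h \<alpha> * monom_hess \<alpha> x v * (t ^ (monom_degree \<alpha> - 1) / (?n \<alpha> - 1)))"
    define \<Psi> where "\<Psi> = (\<lambda>t. mpoly_hess h (t *\<^sub>R x) v)"
    have \<Psi>: "\<Psi> t = (\<Sum>\<alpha>\<in>Poly_Mapping.keys h. Poly_Mapping.lookup h \<alpha> * monom_hess \<alpha> x v * t ^ (monom_degree \<alpha> - 2))" for t
      unfolding \<Psi>_def mpoly_hess_eq_superset[OF finite_keys order_refl] monom_hess_scaleR
      by (simp add: mult_ac)
    have "\<Phi> 1 > 0"
    proof (rule integrated_nonneg_pos)
      fix t :: real
      show "(\<Phi> has_real_derivative \<Phi>' t) (at t)"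
        unfolding \<Phi>_def \<Phi>'_def
      proof (intro DERIV_sum DERIV_cmult)
        fix \<alpha> assume "\<alpha> \<in> Poly_Mapping.keys h"
        then have "?n \<alpha> \<ge> 2" using deg by fastforce
        then show "((\<lambda>t. t ^ monom_degree \<alpha> / (?n \<alpha> * (?n \<alpha> - 1))) has_real_derivative
            t ^ (monom_degree \<alpha> - 1) / (?n \<alpha> - 1)) (at t)"
          using DERIV_cdivide[OF DERIV_pow[of "monom_degree \<alpha>" t], of "?n \<alpha> * (?n \<alpha> - 1)"]
          by (cases "\<alpha> = 0") auto
      qed
      show "(\<Phi>' has_real_derivative \<Psi> t) (at t)"
        unfolding \<Phi>'_def \<Psi>
      proof (intro DERIV_sum DERIV_cmult)
        fix \<alpha> assume "\<alpha> \<in> Poly_Mapping.keys h"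
        then have *: "monom_degree \<alpha> \<ge> 2" using deg by fastforce
        then have "real (monom_degree \<alpha> - 1) = ?n \<alpha> - 1" "?n \<alpha> - 1 \<noteq> 0"
          "monom_degree \<alpha> - 1 - 1 = monom_degree \<alpha> - 2"
          by auto
        then show "((\<lambda>t. t ^ (monom_degree \<alpha> - 1) / (?n \<alpha> - 1)) has_real_derivative
            t ^ (monom_degree \<alpha> - 2)) (at t)"
          using DERIV_cdivide[OF DERIV_pow[of "monom_degree \<alpha> - 1" t], of "?n \<alpha> - 1"] by simp
      qed
      show "\<Psi> t \<ge> 0" unfolding \<Psi>_def by (rule mpoly_hess_nonneg[OF conv])
      show "\<Psi> 0 > 0" unfolding \<Psi>_def using pd[OF \<open>v \<noteq> 0\<close>] by simp
      have "(0::real) ^ monom_degree \<alpha> = 0" "(0::real) ^ (monom_degree \<alpha> - 1) = 0"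
        if "\<alpha> \<in> Poly_Mapping.keys h" for \<alpha>
        using deg[OF that] by (auto simp: power_0_left)
      then show "\<Phi> 0 = 0" "\<Phi>' 0 = 0"
        unfolding \<Phi>_def \<Phi>'_def by (simp_all del: power_eq_0_iff cong: sum.cong)
    qed
    then show "(\<Sum>i\<in>UNIV. \<Sum>j\<in>UNIV. v $ i * v $ j * mpoly_eval (F i j) x) > 0"
      unfolding F by (simp add: \<Phi>_def)
  qed
qed

text \<open>The constant coefficient is the value at 0, and a linear coefficient is a directional
  derivative at the minimum 0.\<close>

lemma keys_degree_ge_2:
  fixes h :: "'n::finite real_mpoly"
  assumes "mpoly_eval h 0 = 0" "\<And>x. mpoly_eval h x \<ge> 0" "\<alpha> \<in> Poly_Mapping.keys h"
  shows "monom_degree \<alpha> \<ge> 2"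
proof (rule ccontr)
  assume "\<not> monom_degree \<alpha> \<ge> 2"
  then consider "monom_degree \<alpha> = 0" | "monom_degree \<alpha> = 1" by linarith
  then show False
  proof cases
    case 1
    have "mpoly_eval h 0 = (\<Sum>\<beta>\<in>Poly_Mapping.keys h. if \<beta> = 0 then Poly_Mapping.lookup h \<beta> else 0)"
      unfolding mpoly_eval_eq by (intro sum.cong refl) (simp add: monom_eval_at_0)
    with 1 assms show False by (simp add: in_keys_iff)
  next
    case 2
    then obtain i where i: "Poly_Mapping.lookup \<alpha> i \<noteq> 0"
      by (metis One_nat_def monom_degree_def sum.neutral zero_neq_one)
    with 2 monom_degree_minus_single[OF i] minus_single_add[OF i] have \<alpha>: "\<alpha> = Poly_Mapping.single i 1"
      by simp
    have "monom_deriv i \<beta> 0 = (if \<beta> = \<alpha> then 1 else 0)" for \<beta>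
    proof (cases "Poly_Mapping.lookup \<beta> i = 0")
      case False
      from minus_single_add[OF False] have "\<beta> - Poly_Mapping.single i 1 = 0 \<longleftrightarrow> \<beta> = \<alpha>"
        unfolding \<alpha> by auto
      then show ?thesis by (simp add: monom_deriv_def monom_eval_at_0 \<alpha>)
    qed (auto simp: monom_deriv_def \<alpha>)
    then have "mpoly_eval (mpoly_deriv i h) 0 = Poly_Mapping.lookup h \<alpha>"
      using assms(3) by (simp add: mpoly_eval_deriv if_distrib[where f = "\<lambda>z. _ * z"] cong: if_cong)
    moreover have "(\<Sum>j\<in>UNIV. axis i 1 $ j * mpoly_eval (mpoly_deriv j h) 0) = mpoly_eval (mpoly_deriv i h) 0"
      by (simp add: axis_def if_distrib[where f = "\<lambda>z. z * _"] cong: if_cong)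
    ultimately have "((\<lambda>t. mpoly_eval h (0 + t *\<^sub>R axis i 1)) has_real_derivative Poly_Mapping.lookup h \<alpha>) (at 0)"
      using mpoly_line_has_derivative[of h 0 "axis i 1" 0] by simp
    then have "Poly_Mapping.lookup h \<alpha> = 0"
      by (rule DERIV_local_min[where d = 1]) (use assms in auto)
    with assms(3) show False by (simp add: in_keys_iff)
  qed
qed

subsection \<open>Sums of squares and preorderings\<close>

lemma sos_0 [simp]: "0 \<in> sos"
  unfolding sos_def by (auto intro: exI[of _ "[]"])

lemma sos_square: "q ^ 2 \<in> sos"
  unfolding sos_def by (auto intro: exI[of _ "[q]"])

lemma sos_add: "a \<in> sos \<Longrightarrow> b \<in> sos \<Longrightarrow> a + b \<in> sos"
  unfolding sos_def by (auto intro: exI[of _ "_ @ _"])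

lemma sos_induct [consumes 1, case_names zero add]:
  assumes "\<sigma> \<in> sos" "P 0" "\<And>q \<sigma>. \<sigma> \<in> sos \<Longrightarrow> P \<sigma> \<Longrightarrow> P (q ^ 2 + \<sigma>)"
  shows "P \<sigma>"
proof -
  from assms(1) obtain qs where "\<sigma> = (\<Sum>q\<leftarrow>qs. q ^ 2)" by (auto simp: sos_def)
  then show ?thesis
    by (induction qs arbitrary: \<sigma>) (use assms in \<open>auto simp: sos_def\<close>)
qed

lemma sos_mult:
  assumes "a \<in> sos" "b \<in> sos" shows "a * b \<in> sos"
  using assms(1)
proof (induction rule: sos_induct)
  case (add q \<sigma>)
  have "q ^ 2 * b \<in> sos"
    using assms(2)
  proof (induction rule: sos_induct)
    case (add r \<tau>)
    have "q ^ 2 * (r ^ 2 + \<tau>) = (q * r) ^ 2 + q ^ 2 * \<tau>"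
      by (simp add: algebra_simps power2_eq_square)
    with add show ?case by (metis sos_add sos_square)
  qed simp
  with add show ?case by (simp add: distrib_right sos_add)
qed simp

text \<open>Carries certificates back through the linear change of coordinates.\<close>

lemma sos_subst:
  fixes \<theta> :: "'n::finite \<Rightarrow> 'k::finite real_mpoly"
  shows "\<sigma> \<in> sos \<Longrightarrow> mpoly_subst \<theta> \<sigma> \<in> sos"
proof (induction rule: sos_induct)
  case zero
  have "mpoly_subst \<theta> 0 = 0" by (rule mpoly_eval_inject) simp
  then show ?case by simp
next
  case (add q \<sigma>)
  have "mpoly_subst \<theta> (q ^ 2 + \<sigma>) = mpoly_subst \<theta> q ^ 2 + mpoly_subst \<theta> \<sigma>"
    by (rule mpoly_eval_inject) simp
  with add show ?case by (metis sos_add sos_square)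
qed

text \<open>Improper preorderings, those containing -1, are allowed; properness is stated separately
  where it matters.\<close>

locale preordering =
  fixes T :: "'a::comm_ring_1 set"
  assumes add_closed: "a \<in> T \<Longrightarrow> b \<in> T \<Longrightarrow> a + b \<in> T"
    and mult_closed: "a \<in> T \<Longrightarrow> b \<in> T \<Longrightarrow> a * b \<in> T"
    and square_mem: "a ^ 2 \<in> T"
begin

lemma zero_mem: "0 \<in> T"
  using square_mem[of 0] by simp

lemma one_mem: "1 \<in> T"
  using square_mem[of 1] by simp

lemma sum_mem: "(\<And>i. i \<in> I \<Longrightarrow> p i \<in> T) \<Longrightarrow> (\<Sum>i\<in>I. p i) \<in> T"
  by (induction I rule: infinite_finite_induct) (auto intro: add_closed zero_mem)

lemma prod_mem: "(\<And>i. i \<in> I \<Longrightarrow> p i \<in> T) \<Longrightarrow> (\<Prod>i\<in>I. p i) \<in> T"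
  by (induction I rule: infinite_finite_induct) (auto intro: mult_closed one_mem)

lemma power_mem: "a \<in> T \<Longrightarrow> a ^ k \<in> T"
  by (induction k) (auto intro: mult_closed one_mem)

end

lemma mpoly_const_sqrt:
  assumes "c \<ge> 0" shows "mpoly_const c = (mpoly_const (sqrt c) :: 'n::finite real_mpoly) ^ 2"
  by (rule mpoly_eval_inject) (use assms in simp)

lemma sos_const: "c \<ge> 0 \<Longrightarrow> (mpoly_const c :: 'n::finite real_mpoly) \<in> sos"
  using mpoly_const_sqrt sos_square by metis

lemma preordering_const_mem:
  fixes T :: "'n::finite real_mpoly set"
  assumes "preordering T" "c \<ge> 0" shows "mpoly_const c \<in> T"
  using assms mpoly_const_sqrt preordering.square_mem by metis

lemma preordering_sos_subset:
  assumes "preordering T" "\<sigma> \<in> sos" shows "\<sigma> \<in> T"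
  using assms(2)
proof (induction rule: sos_induct)
  case zero then show ?case using preordering.zero_mem[OF assms(1)] .
next
  case (add q \<sigma>) then show ?case
    using preordering.square_mem[OF assms(1)] preordering.add_closed[OF assms(1)] by blast
qed

section \<open>Positive definite quadratic forms as sums of squares\<close>

lemma complete_square_insert:
  fixes b :: "'n \<Rightarrow> 'n \<Rightarrow> real"
  assumes "finite I" "k \<notin> I" "b k k \<noteq> 0" and sym: "\<And>i j. b i j = b j i"
  shows "(\<Sum>i\<in>insert k I. \<Sum>j\<in>insert k I. b i j * y i * y j) =
    b k k * (y k + (\<Sum>j\<in>I. b k j / b k k * y j)) ^ 2 +
    (\<Sum>i\<in>I. \<Sum>j\<in>I. (b i j - b k i * b k j / b k k) * y i * y j)"
proof -
  define s where "s = (\<Sum>j\<in>I. b k j * y j)"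
  have 1: "(\<Sum>j\<in>I. b k j / b k k * y j) = s / b k k"
    by (simp add: s_def sum_divide_distrib)
  have 2: "(\<Sum>i\<in>I. \<Sum>j\<in>I. b k i * b k j / b k k * y i * y j) = s * s / b k k"
    by (simp add: s_def sum_product sum_divide_distrib mult_ac)
  have 3: "(\<Sum>j\<in>I. b k j * y k * y j) = y k * s" "(\<Sum>i\<in>I. b i k * y i * y k) = y k * s"
    by (simp_all add: s_def sum_distrib_left mult_ac sym[of _ k])
  have "(\<Sum>i\<in>insert k I. \<Sum>j\<in>insert k I. b i j * y i * y j) =
      b k k * y k ^ 2 + 2 * (y k * s) + (\<Sum>i\<in>I. \<Sum>j\<in>I. b i j * y i * y j)"
    using assms(1,2) by (simp add: sum.distrib 3 power2_eq_square)
  moreover have "(\<Sum>i\<in>I. \<Sum>j\<in>I. (b i j - b k i * b k j / b k k) * y i * y j) =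
      (\<Sum>i\<in>I. \<Sum>j\<in>I. b i j * y i * y j) - s * s / b k k"
    by (simp only: left_diff_distrib sum_subtractf 2)
  moreover have "b k k * (y k + s / b k k) ^ 2 = b k k * y k ^ 2 + 2 * (y k * s) + s * s / b k k"
    using assms(3) by (simp add: field_simps power2_eq_square)
  ultimately show ?thesis
    unfolding 1 by linarith
qed

text \<open>Lagrange's reduction: split off the square belonging to the pivot \<open>b k k\<close>;
  what remains is the Schur complement \<open>b'\<close> on \<open>I\<close>, again positive
  definite.\<close>

lemma positive_definite_form_sos:
  fixes b :: "'n::finite \<Rightarrow> 'n \<Rightarrow> real"
  assumes "finite I" "\<And>i j. b i j = b j i"
    and "\<And>y. \<exists>i\<in>I. y i \<noteq> 0 \<Longrightarrow> (\<Sum>i\<in>I. \<Sum>j\<in>I. b i j * y i * y j) > 0"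
  shows "\<exists>s\<in>sos. \<forall>x. mpoly_eval s x = (\<Sum>i\<in>I. \<Sum>j\<in>I. b i j * x $ i * x $ j)"
  using assms
proof (induction I arbitrary: b rule: finite_induct)
  case empty
  show ?case by (rule bexI[of _ 0]) auto
next
  case (insert k I)
  have "(\<Sum>i\<in>insert k I. \<Sum>j\<in>insert k I. b i j * (if i = k then 1 else 0) * (if j = k then 1 else 0)) = b k k"
  proof -
    have "i \<noteq> k" if "i \<in> I" for i using that insert.hyps by auto
    then show ?thesis using insert.hyps by (simp cong: sum.cong)
  qed
  with insert.prems(2)[of "\<lambda>i. if i = k then 1 else 0"] have bkk: "b k k > 0" by simp
  define b' where "b' = (\<lambda>i j. b i j - b k i * b k j / b k k)"
  note split = complete_square_insert[of I k b, OF insert.hyps(1,2) less_imp_neq[OF bkk, symmetric] insert.prems(1),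
      folded b'_def]
  have "\<exists>s\<in>sos. \<forall>x. mpoly_eval s x = (\<Sum>i\<in>I. \<Sum>j\<in>I. b' i j * x $ i * x $ j)"
  proof (rule insert.IH)
    fix i j show "b' i j = b' j i" using insert.prems(1)[of i j] by (simp add: b'_def)
  next
    fix y :: "'n \<Rightarrow> real" assume y: "\<exists>i\<in>I. y i \<noteq> 0"
    \<comment> \<open>The \<open>k\<close>-coordinate is chosen to annihilate the split-off square,
      so the Schur complement at \<open>y\<close> equals the full form at \<open>z\<close>.\<close>
    define z where "z = y(k := - (\<Sum>j\<in>I. b k j / b k k * y j))"
    have z: "z j = y j" if "j \<in> I" for j using that insert.hyps by (auto simp: z_def)
    have "(\<Sum>i\<in>I. \<Sum>j\<in>I. b' i j * z i * z j) > 0"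
    proof -
      have "z k + (\<Sum>j\<in>I. b k j / b k k * z j) = 0"
        using z by (simp add: z_def[of] fun_upd_def[of y] cong: sum.cong)
      then show ?thesis
        using split[of z] insert.prems(2)[of z] y z by (auto simp: b'_def)
    qed
    then show "(\<Sum>i\<in>I. \<Sum>j\<in>I. b' i j * y i * y j) > 0"
      using z by (simp add: b'_def)
  qed
  then obtain s where s: "s \<in> sos" "\<And>x. mpoly_eval s x = (\<Sum>i\<in>I. \<Sum>j\<in>I. b' i j * x $ i * x $ j)"
    by auto
  let ?q = "mpoly_var k + (\<Sum>j\<in>I. mpoly_const (b k j / b k k) * mpoly_var j)"
  have "mpoly_const (b k k) * ?q ^ 2 + s \<in> sos"
    using s bkk by (intro sos_add sos_mult sos_const sos_square) auto
  moreover have "mpoly_eval (mpoly_const (b k k) * ?q ^ 2 + s) x =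
      (\<Sum>i\<in>insert k I. \<Sum>j\<in>insert k I. b i j * x $ i * x $ j)" for x
    unfolding split using s(2)[of x] by (simp add: b'_def)
  ultimately show ?case by blast
qed

subsection \<open>Bernstein expansion\<close>

text \<open>Multiply \<open>u ^ k\<close> by (u + (1 - u))^(N - k), which is 1, and expand; the rest
  is an identity of binomial coefficients.\<close>

lemma power_bernstein:
  fixes u :: real
  assumes "k \<le> N"
  shows "u ^ k = (\<Sum>j\<le>N. real (j choose k) / real (N choose k) * (real (N choose j) * u ^ j * (1 - u) ^ (N - j)))"
proof -
  have "u ^ k = u ^ k * (u + (1 - u)) ^ (N - k)" by simp
  also have "\<dots> = (\<Sum>i\<le>N-k. real ((N - k) choose i) * u ^ (i + k) * (1 - u) ^ (N - (i + k)))"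
    unfolding binomial_ring sum_distrib_left using assms
    by (intro sum.cong refl) (simp add: power_add mult_ac add_ac)
  also have "\<dots> = (\<Sum>j=k..N. real ((N - k) choose (j - k)) * u ^ j * (1 - u) ^ (N - j))"
    by (rule sum.reindex_bij_witness[of _ "\<lambda>j. j - k" "\<lambda>i. i + k"]) (use assms in auto)
  also have "\<dots> = (\<Sum>j=k..N. real (j choose k) / real (N choose k) * (real (N choose j) * u ^ j * (1 - u) ^ (N - j)))"
  proof (rule sum.cong[OF refl])
    fix j assume j: "j \<in> {k..N}"
    have "real (N choose j) * real (j choose k) = real (N choose k) * real ((N - k) choose (j - k))"
      using choose_mult[of k j N] j by (simp flip: of_nat_mult)
    moreover have "real (N choose k) \<noteq> 0" using assms by (simp add: not_less)
    ultimately have "real ((N - k) choose (j - k)) = real (j choose k) / real (N choose k) * real (N choose j)"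
      by (simp add: field_simps)
    then show "real ((N - k) choose (j - k)) * u ^ j * (1 - u) ^ (N - j) =
        real (j choose k) / real (N choose k) * (real (N choose j) * u ^ j * (1 - u) ^ (N - j))"
      by simp
  qed
  also have "\<dots> = (\<Sum>j\<le>N. real (j choose k) / real (N choose k) * (real (N choose j) * u ^ j * (1 - u) ^ (N - j)))"
    by (rule sum.mono_neutral_left) (auto simp: not_le)
  finally show ?thesis .
qed

text \<open>The ratio is the product of (j - l)/(N - l) for l < k, and each factor is within 2K/N of
  j/N. The condition \<open>2 * K \<le> N\<close> keeps denominators above N/2 and also keeps the
  factors with j < l in absolute value at most 1, so a difference of products is at most the sum of
  the differences of the factors.\<close>

lemma choose_ratio_approx:
  assumes "k \<le> K" "2 * K \<le> N" "0 < N" "j \<le> N"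
  shows "\<bar>real (j choose k) / real (N choose k) - (real j / real N) ^ k\<bar> \<le> 2 * real K ^ 2 / real N"
proof -
  let ?z = "\<lambda>l. (real j - real l) / (real N - real l)"
  have "real (j choose k) / real (N choose k) = (\<Prod>l=0..<k. ?z l)"
    by (simp add: binomial_gbinomial gbinomial_prod_rev prod_dividef)
  moreover have "(real j / real N) ^ k = (\<Prod>l=0..<k. real j / real N)" by simp
  moreover have "norm ((\<Prod>l=0..<k. ?z l) - (\<Prod>l=0..<k. real j / real N)) \<le>
      (\<Sum>l=0..<k. norm (?z l - real j / real N))"
  proof (rule norm_prod_diff)
    fix l assume "l \<in> {0..<k}"
    then have "real l \<le> real N - real l" "0 < real N - real l" using assms by auto
    moreover have "\<bar>real j - real l\<bar> \<le> real N - real l"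
      using \<open>real l \<le> real N - real l\<close> assms(4) by (auto simp: abs_le_iff)
    ultimately show "norm (?z l) \<le> 1" by simp
    show "norm (real j / real N) \<le> 1" using assms by simp
  qed
  moreover have "(\<Sum>l=0..<k. norm (?z l - real j / real N)) \<le> (\<Sum>l=0..<k. 2 * real K / real N)"
  proof (rule sum_mono)
    fix l assume "l \<in> {0..<k}"
    then have l: "real N / 2 \<le> real N - real l" "real l \<le> real K" "0 < real N - real l" using assms by auto
    have "?z l - real j / real N = - (real l / (real N - real l) * ((real N - real j) / real N))"
      using l assms by (simp add: field_simps)
    then have "norm (?z l - real j / real N) = real l / (real N - real l) * ((real N - real j) / real N)"
      using l assms by (simp add: abs_mult)
    also have "\<dots> \<le> real l / (real N - real l) * 1"
      using l assms by (intro mult_left_mono) auto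
    also have "\<dots> \<le> real K / (real N / 2)"
      unfolding mult_1_right by (rule frac_le) (use l assms in auto)
    finally show "norm (?z l - real j / real N) \<le> 2 * real K / real N" by (simp add: mult.commute)
  qed
  moreover have "(\<Sum>l=0..<k. 2 * real K / real N) \<le> 2 * real K ^ 2 / real N"
    using assms by (simp add: power2_eq_square divide_right_mono mult_right_mono)
  ultimately show ?thesis by simp
qed

text \<open>Coefficient at index \<open>J\<close> of the monomial \<open>\<alpha>\<close> in the
  tensor-product Bernstein basis of degree \<open>N\<close> in each variable on the unit
  cube.\<close>

definition bernstein_coeff :: "nat \<Rightarrow> ('n::finite \<Rightarrow> nat) \<Rightarrow> ('n \<Rightarrow>\<^sub>0 nat) \<Rightarrow> real" where
  "bernstein_coeff N J \<alpha> =
     (\<Prod>i\<in>UNIV. real (J i choose Poly_Mapping.lookup \<alpha> i) / real (N choose Poly_Mapping.lookup \<alpha> i))"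

lemma monom_eval_bernstein:
  assumes "\<And>i. Poly_Mapping.lookup \<alpha> i \<le> N"
  shows "monom_eval \<alpha> u = (\<Sum>J\<in>UNIV \<rightarrow>\<^sub>E {..N}. bernstein_coeff N J \<alpha> *
    (\<Prod>i\<in>UNIV. real (N choose J i) * (u $ i) ^ J i * (1 - u $ i) ^ (N - J i)))"
proof -
  have "monom_eval \<alpha> u = (\<Prod>i\<in>UNIV. \<Sum>j\<le>N. real (j choose Poly_Mapping.lookup \<alpha> i) /
      real (N choose Poly_Mapping.lookup \<alpha> i) * (real (N choose j) * (u $ i) ^ j * (1 - u $ i) ^ (N - j)))"
    unfolding monom_eval_def by (intro prod.cong refl power_bernstein assms)
  also have "\<dots> = (\<Sum>J\<in>UNIV \<rightarrow>\<^sub>E {..N}. \<Prod>i\<in>UNIV. real (J i choose Poly_Mapping.lookup \<alpha> i) /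
      real (N choose Poly_Mapping.lookup \<alpha> i) * (real (N choose J i) * (u $ i) ^ J i * (1 - u $ i) ^ (N - J i)))"
    by (rule prod_sum_PiE) auto
  finally show ?thesis by (simp only: bernstein_coeff_def prod.distrib)
qed

text \<open>For large \<open>N\<close> Bernstein coefficients are close to values at the grid points
  J/N, uniformly over a finite set of monomials.\<close>

lemma bernstein_coeff_approx:
  fixes A :: "('n::finite \<Rightarrow>\<^sub>0 nat) set"
  assumes "finite A" "\<epsilon> > 0"
  obtains N where "0 < N" "\<And>\<alpha> i. \<alpha> \<in> A \<Longrightarrow> Poly_Mapping.lookup \<alpha> i \<le> N"
    "\<And>\<alpha> J. \<alpha> \<in> A \<Longrightarrow> (\<And>i. J i \<le> N) \<Longrightarrow>
       \<bar>bernstein_coeff N J \<alpha> - monom_eval \<alpha> (\<chi> i. real (J i) / real N)\<bar> \<le> \<epsilon>"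
proof -
  define K where "K = Max (insert 0 ((\<lambda>(\<alpha>, i). Poly_Mapping.lookup \<alpha> i) ` (A \<times> (UNIV :: 'n set))))"
  have K: "Poly_Mapping.lookup \<alpha> i \<le> K" if "\<alpha> \<in> A" for \<alpha> i
    unfolding K_def using assms that by (intro Max_ge) auto
  \<comment> \<open>\<open>D / N\<close> is the total error: one bound from
    \<open>choose_ratio_approx\<close> for each variable.\<close>
  define D where "D = real CARD('n) * (2 * real K ^ 2)"
  obtain N0 where N0: "real N0 > D / \<epsilon>" using reals_Archimedean2 by blast
  define N where "N = Suc (N0 + 2 * K)"
  have N: "0 < N" "2 * K \<le> N" "D / real N \<le> \<epsilon>"
  proof -
    have "D / \<epsilon> \<le> real N" using N0 by (simp add: N_def)
    then show "D / real N \<le> \<epsilon>" using assms(2) by (simp add: N_def field_simps)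
  qed (auto simp: N_def)
  show ?thesis
  proof
    show "0 < N" by (rule N)
    show "Poly_Mapping.lookup \<alpha> i \<le> N" if "\<alpha> \<in> A" for \<alpha> i
      using K[OF that, of i] N by simp
    fix \<alpha> and J :: "'n \<Rightarrow> nat" assume \<alpha>: "\<alpha> \<in> A" and J: "\<And>i. J i \<le> N"
    let ?z = "\<lambda>i. real (J i choose Poly_Mapping.lookup \<alpha> i) / real (N choose Poly_Mapping.lookup \<alpha> i)"
    let ?w = "\<lambda>i. (real (J i) / real N) ^ Poly_Mapping.lookup \<alpha> i"
    have "norm ((\<Prod>i\<in>UNIV. ?z i) - (\<Prod>i\<in>UNIV. ?w i)) \<le> (\<Sum>i\<in>UNIV. norm (?z i - ?w i))"
    proof (rule norm_prod_diff)
      fix i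
      have "J i choose Poly_Mapping.lookup \<alpha> i \<le> N choose Poly_Mapping.lookup \<alpha> i"
        by (rule binomial_right_mono) (rule J)
      then show "norm (?z i) \<le> 1" by (auto simp: divide_le_eq_1)
      show "norm (?w i) \<le> 1" using J[of i] N(1) by (auto intro!: power_le_one)
    qed
    also have "\<dots> \<le> (\<Sum>i\<in>(UNIV :: 'n set). 2 * real K ^ 2 / real N)"
      using choose_ratio_approx[OF K[OF \<alpha>] N(2,1) J] by (intro sum_mono) simp
    also have "\<dots> \<le> \<epsilon>" using N(3) by (simp add: D_def)
    finally show "\<bar>bernstein_coeff N J \<alpha> - monom_eval \<alpha> (\<chi> i. real (J i) / real N)\<bar> \<le> \<epsilon>"
      by (simp add: bernstein_coeff_def monom_eval_def)
  qed
qed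

text \<open>In the Bernstein basis of high degree the coefficient matrices of \<open>F\<close> are close to values of \<open>F\<close>,
  hence positive definite, so that \<open>x\<^sup>T F(x) x\<close> is a sum of products of constraints and squares.\<close>
theorem positive_definite_form_mem_preordering:
  fixes F :: "'n::finite \<Rightarrow> 'n \<Rightarrow> 'n real_mpoly"
  assumes T: "preordering T" and "R > 0"
    and upper: "\<And>i. mpoly_const R - mpoly_var i \<in> T"
    and lower: "\<And>i. mpoly_const R + mpoly_var i \<in> T"
    and pd: "\<And>x v. v \<noteq> 0 \<Longrightarrow> (\<Sum>i\<in>UNIV. \<Sum>j\<in>UNIV. v $ i * v $ j * mpoly_eval (F i j) x) > 0"
    and h: "\<And>x. mpoly_eval h x = (\<Sum>i\<in>UNIV. \<Sum>j\<in>UNIV. x $ i * x $ j * mpoly_eval (F i j) x)"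
  shows "h \<in> T"
proof -
  interpret preordering T by (rule T)
  \<comment> \<open>The map \<open>U\<close> takes the box of half-width \<open>R\<close> to the
    unit cube, where the Bernstein basis lives; \<open>F'\<close> is \<open>F\<close> in cube
    coordinates.\<close>
  define F' where "F' = (\<lambda>i j. mpoly_subst (\<lambda>k. mpoly_const (2 * R) * mpoly_var k - mpoly_const R) (F i j))"
  define U :: "'n \<Rightarrow> 'n real_mpoly" where
    "U = (\<lambda>i. mpoly_const (1 / (2 * R)) * (mpoly_const R + mpoly_var i))"
  define u :: "real ^ 'n \<Rightarrow> real ^ 'n" where "u = (\<lambda>x. \<chi> i. mpoly_eval (U i) x)"
  define Q where "Q = (\<lambda>w v. \<Sum>i\<in>UNIV. \<Sum>j\<in>UNIV. v $ i * v $ j * mpoly_eval (F' i j) w)"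
  define A where "A = (\<Union>i. \<Union>j. Poly_Mapping.keys (F' i j))"
  have "finite A" by (simp add: A_def)
  have F': "mpoly_eval (F' i j) w = (\<Sum>\<alpha>\<in>A. Poly_Mapping.lookup (F' i j) \<alpha> * monom_eval \<alpha> w)" for i j w
    by (rule mpoly_eval_superset) (auto simp: \<open>finite A\<close>, auto simp: A_def)
  have F'_u: "mpoly_eval (F' i j) (u x) = mpoly_eval (F i j) x" for i j x
  proof -
    have "(\<chi> k. 2 * R * u x $ k - R) = x"
      using \<open>R > 0\<close> by (simp add: vec_eq_iff u_def U_def)
    then show ?thesis by (simp add: F'_def)
  qed
  have Q_pos: "Q w v > 0" if "v \<noteq> 0" for w v
    unfolding Q_def F'_def using pd[OF that] by simp
  obtain \<mu> where \<mu>: "\<mu> > 0" "\<And>w v. w \<in> cbox 0 1 \<Longrightarrow> norm v = 1 \<Longrightarrow> Q w v \<ge> \<mu>"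
  proof -
    let ?K = "cbox 0 1 \<times> sphere 0 1 :: ((real ^ 'n) \<times> (real ^ 'n)) set"
    have "continuous_on ?K (\<lambda>p. Q (fst p) (snd p))"
      unfolding Q_def
      by (intro continuous_intros continuous_on_compose2[OF continuous_on_mpoly_eval[of UNIV]]) auto
    moreover have "compact ?K" by (intro compact_Times compact_cbox compact_sphere)
    moreover have "(0, axis undefined 1) \<in> ?K" by (simp add: mem_box_cart)
    ultimately have "\<exists>p\<in>?K. \<forall>q\<in>?K. Q (fst p) (snd p) \<le> Q (fst q) (snd q)"
      by (intro continuous_attains_inf) blast+
    then obtain p where p: "p \<in> ?K" "\<And>q. q \<in> ?K \<Longrightarrow> Q (fst p) (snd p) \<le> Q (fst q) (snd q)"
      by blast
    have "snd p \<noteq> 0" using p(1) by auto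
    show ?thesis
    proof
      show "0 < Q (fst p) (snd p)" by (rule Q_pos) fact
      show "Q w v \<ge> Q (fst p) (snd p)" if "w \<in> cbox 0 1" "norm v = 1" for w v
        using p(2)[of "(w, v)"] that by simp
    qed
  qed
  \<comment> \<open>For a unit vector all products of two coordinates have absolute value at most 1,
    so passing from values to Bernstein coefficients changes the form by at most
    \<open>C * \<epsilon>\<close>. Dividing \<open>\<mu>\<close> by \<open>C + 1\<close> keeps this
    below \<open>\<mu>\<close>, also when \<open>C\<close> is 0.\<close>
  define C where "C = (\<Sum>i\<in>UNIV. \<Sum>j\<in>UNIV. \<Sum>\<alpha>\<in>A. \<bar>Poly_Mapping.lookup (F' i j) \<alpha>\<bar>)"
  have "C \<ge> 0" unfolding C_def by (intro sum_nonneg) auto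
  define \<epsilon> where "\<epsilon> = \<mu> / (C + 1)"
  have "\<epsilon> > 0" using \<mu>(1) \<open>C \<ge> 0\<close> by (simp add: \<epsilon>_def)
  have "C * \<epsilon> < \<mu>" using \<mu>(1) \<open>C \<ge> 0\<close> by (simp add: \<epsilon>_def field_simps)
  obtain N where N: "0 < N" "\<And>\<alpha> i. \<alpha> \<in> A \<Longrightarrow> Poly_Mapping.lookup \<alpha> i \<le> N"
    "\<And>\<alpha> J. \<alpha> \<in> A \<Longrightarrow> (\<And>i. J i \<le> N) \<Longrightarrow>
       \<bar>bernstein_coeff N J \<alpha> - monom_eval \<alpha> (\<chi> i. real (J i) / real N)\<bar> \<le> \<epsilon>"
    using bernstein_coeff_approx[OF \<open>finite A\<close> \<open>\<epsilon> > 0\<close>] by metis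
  define b where "b = (\<lambda>J i j. \<Sum>\<alpha>\<in>A. Poly_Mapping.lookup (F' i j) \<alpha> * bernstein_coeff N J \<alpha>)"
  let ?P = "UNIV \<rightarrow>\<^sub>E {..N} :: ('n \<Rightarrow> nat) set"
  have pos1: "(\<Sum>i\<in>UNIV. \<Sum>j\<in>UNIV. b J i j * v $ i * v $ j) > 0"
    if J: "\<And>i. J i \<le> N" and v: "norm v = 1" for J :: "'n \<Rightarrow> nat" and v :: "real ^ 'n"
  proof -
    define w :: "real ^ 'n" where "w = (\<chi> i. real (J i) / real N)"
    have "w \<in> cbox 0 1" using J N(1) by (simp add: mem_box_cart w_def)
    have v1: "\<bar>v $ i * v $ j\<bar> \<le> 1" for i j
      using component_le_norm_cart[of v i] component_le_norm_cart[of v j] v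
      by (simp add: abs_mult mult_le_one)
    have "\<bar>(b J i j - mpoly_eval (F' i j) w) * (v $ i * v $ j)\<bar> \<le> (\<Sum>\<alpha>\<in>A. \<bar>Poly_Mapping.lookup (F' i j) \<alpha>\<bar> * \<epsilon>)" for i j
    proof -
      have "\<bar>b J i j - mpoly_eval (F' i j) w\<bar> =
          \<bar>\<Sum>\<alpha>\<in>A. Poly_Mapping.lookup (F' i j) \<alpha> * (bernstein_coeff N J \<alpha> - monom_eval \<alpha> w)\<bar>"
        by (simp add: b_def F' sum_subtractf right_diff_distrib)
      also have "\<dots> \<le> (\<Sum>\<alpha>\<in>A. \<bar>Poly_Mapping.lookup (F' i j) \<alpha> * (bernstein_coeff N J \<alpha> - monom_eval \<alpha> w)\<bar>)"
        by (rule sum_abs)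
      also have "\<dots> \<le> (\<Sum>\<alpha>\<in>A. \<bar>Poly_Mapping.lookup (F' i j) \<alpha>\<bar> * \<epsilon>)"
        unfolding abs_mult w_def by (intro sum_mono mult_left_mono N(3) J) auto
      finally have "\<bar>b J i j - mpoly_eval (F' i j) w\<bar> \<le> (\<Sum>\<alpha>\<in>A. \<bar>Poly_Mapping.lookup (F' i j) \<alpha>\<bar> * \<epsilon>)" .
      with mult_left_le[OF v1[of i j], of "\<bar>b J i j - mpoly_eval (F' i j) w\<bar>"] show ?thesis
        unfolding abs_mult[of "b J i j - _"] by simp
    qed
    then have "(\<Sum>i\<in>UNIV. \<Sum>j\<in>UNIV. \<bar>(b J i j - mpoly_eval (F' i j) w) * (v $ i * v $ j)\<bar>) \<le> C * \<epsilon>"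
      unfolding C_def sum_distrib_right by (intro sum_mono)
    moreover have "\<bar>\<Sum>i\<in>UNIV. \<Sum>j\<in>UNIV. (b J i j - mpoly_eval (F' i j) w) * (v $ i * v $ j)\<bar> \<le>
        (\<Sum>i\<in>UNIV. \<Sum>j\<in>UNIV. \<bar>(b J i j - mpoly_eval (F' i j) w) * (v $ i * v $ j)\<bar>)"
      by (rule order_trans[OF sum_abs]) (intro sum_mono sum_abs)
    moreover have "(\<Sum>i\<in>UNIV. \<Sum>j\<in>UNIV. (b J i j - mpoly_eval (F' i j) w) * (v $ i * v $ j)) =
        (\<Sum>i\<in>UNIV. \<Sum>j\<in>UNIV. b J i j * v $ i * v $ j) - Q w v"
      unfolding Q_def left_diff_distrib sum_subtractf by (simp only: mult_ac)
    ultimately show ?thesis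
      using \<mu>(2)[OF \<open>w \<in> cbox 0 1\<close> v] \<open>C * \<epsilon> < \<mu>\<close> by linarith
  qed
  have "\<exists>s\<in>sos. \<forall>x. mpoly_eval s x = (\<Sum>i\<in>UNIV. \<Sum>j\<in>UNIV. b J i j * x $ i * x $ j)" if J: "J \<in> ?P" for J
  proof -
    \<comment> \<open>\<open>F\<close> is not assumed symmetric, whereas completing squares needs
      symmetric coefficients; averaging with the transpose leaves the form unchanged.\<close>
    let ?b = "\<lambda>i j. (b J i j + b J j i) / 2"
    have sym: "(\<Sum>i\<in>UNIV. \<Sum>j\<in>UNIV. ?b i j * y i * y j) = (\<Sum>i\<in>UNIV. \<Sum>j\<in>UNIV. b J i j * y i * y j)"
      for y :: "'n \<Rightarrow> real"
    proof -
      have "(\<Sum>i\<in>UNIV. \<Sum>j\<in>UNIV. b J j i * y i * y j) = (\<Sum>i\<in>UNIV. \<Sum>j\<in>UNIV. b J i j * y i * y j)"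
        by (subst sum.swap) (simp add: mult_ac)
      moreover have "(\<Sum>i\<in>UNIV. \<Sum>j\<in>UNIV. ?b i j * y i * y j) =
          ((\<Sum>i\<in>UNIV. \<Sum>j\<in>UNIV. b J i j * y i * y j) + (\<Sum>i\<in>UNIV. \<Sum>j\<in>UNIV. b J j i * y i * y j)) / 2"
        by (simp add: sum.distrib[symmetric] sum_divide_distrib add_divide_distrib distrib_right)
      ultimately show ?thesis by simp
    qed
    have "\<exists>s\<in>sos. \<forall>x. mpoly_eval s x = (\<Sum>i\<in>UNIV. \<Sum>j\<in>UNIV. ?b i j * x $ i * x $ j)"
    proof (rule positive_definite_form_sos)
      fix y :: "'n \<Rightarrow> real" assume "\<exists>i\<in>UNIV. y i \<noteq> 0"
      define v :: "real ^ 'n" where "v = (\<chi> i. y i)"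
      have "v \<noteq> 0" using \<open>\<exists>i\<in>UNIV. y i \<noteq> 0\<close> by (simp add: v_def vec_eq_iff)
      define v' where "v' = v /\<^sub>R norm v"
      have "norm v' = 1" using \<open>v \<noteq> 0\<close> by (simp add: v'_def)
      have "J i \<le> N" for i using J by auto
      from pos1[OF this \<open>norm v' = 1\<close>]
      have "(norm v) ^ 2 * (\<Sum>i\<in>UNIV. \<Sum>j\<in>UNIV. b J i j * v' $ i * v' $ j) > 0"
        using \<open>v \<noteq> 0\<close> by simp
      also have "(norm v) ^ 2 * (\<Sum>i\<in>UNIV. \<Sum>j\<in>UNIV. b J i j * v' $ i * v' $ j) =
          (\<Sum>i\<in>UNIV. \<Sum>j\<in>UNIV. b J i j * (norm v * v' $ i) * (norm v * v' $ j))"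
        by (simp add: sum_distrib_left power2_eq_square mult_ac)
      finally have "(\<Sum>i\<in>UNIV. \<Sum>j\<in>UNIV. b J i j * (norm v * v' $ i) * (norm v * v' $ j)) > 0" .
      moreover have "norm v * v' $ i = y i" for i
        using \<open>v \<noteq> 0\<close> by (simp add: v'_def) (simp add: v_def)
      ultimately show "(\<Sum>i\<in>UNIV. \<Sum>j\<in>UNIV. ?b i j * y i * y j) > 0"
        by (simp only: sym)
    qed auto
    then show ?thesis by (simp only: sym)
  qed
  then have "\<forall>J\<in>?P. \<exists>s. s \<in> sos \<and> (\<forall>x. mpoly_eval s x = (\<Sum>i\<in>UNIV. \<Sum>j\<in>UNIV. b J i j * x $ i * x $ j))"
    by blast
  from bchoice[OF this] obtain s where s: "\<And>J. J \<in> ?P \<Longrightarrow> s J \<in> sos"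
    "\<And>J x. J \<in> ?P \<Longrightarrow> mpoly_eval (s J) x = (\<Sum>i\<in>UNIV. \<Sum>j\<in>UNIV. b J i j * x $ i * x $ j)"
    by blast
  \<comment> \<open>The Bernstein basis polynomials, composed with \<open>U\<close>; they lie in
    \<open>T\<close> because \<open>U i\<close> and \<open>1 - U i\<close> do.\<close>
  let ?B = "\<lambda>J. \<Prod>i\<in>UNIV. mpoly_const (real (N choose J i)) * U i ^ J i * (1 - U i) ^ (N - J i)"
  have h_eq: "h = (\<Sum>J\<in>?P. ?B J * s J)"
  proof (rule mpoly_eval_inject)
    fix x
    let ?Bx = "\<lambda>J. \<Prod>i\<in>UNIV. real (N choose J i) * (u x $ i) ^ J i * (1 - u x $ i) ^ (N - J i)"
    have B: "mpoly_eval (?B J) x = ?Bx J" for J by (simp add: u_def)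
    have Feq: "mpoly_eval (F i j) x = (\<Sum>J\<in>?P. ?Bx J * b J i j)" for i j
    proof -
      have "mpoly_eval (F i j) x = (\<Sum>\<alpha>\<in>A. \<Sum>J\<in>?P. ?Bx J * (Poly_Mapping.lookup (F' i j) \<alpha> * bernstein_coeff N J \<alpha>))"
        unfolding F'_u[symmetric] F' 
      proof (rule sum.cong[OF refl])
        fix \<alpha> assume "\<alpha> \<in> A"
        show "Poly_Mapping.lookup (F' i j) \<alpha> * monom_eval \<alpha> (u x) =
            (\<Sum>J\<in>?P. ?Bx J * (Poly_Mapping.lookup (F' i j) \<alpha> * bernstein_coeff N J \<alpha>))"
          unfolding monom_eval_bernstein[OF N(2)[OF \<open>\<alpha> \<in> A\<close>], of "u x"] sum_distrib_left
          by (intro sum.cong refl) (simp only: mult_ac)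
      qed
      also have "\<dots> = (\<Sum>J\<in>?P. ?Bx J * b J i j)"
        unfolding b_def sum_distrib_left by (rule sum.swap)
      finally show ?thesis .
    qed
    have "mpoly_eval (\<Sum>J\<in>?P. ?B J * s J) x = (\<Sum>J\<in>?P. ?Bx J * mpoly_eval (s J) x)"
      by (simp only: mpoly_eval_sum mpoly_eval_mult[of "?B _"] B)
    also have "\<dots> = (\<Sum>J\<in>?P. \<Sum>i\<in>UNIV. \<Sum>j\<in>UNIV. x $ i * x $ j * (?Bx J * b J i j))"
      by (intro sum.cong refl) (simp only: s(2) sum_distrib_left, simp only: mult_ac)
    also have "\<dots> = (\<Sum>i\<in>UNIV. \<Sum>J\<in>?P. \<Sum>j\<in>UNIV. x $ i * x $ j * (?Bx J * b J i j))"
      by (rule sum.swap)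
    also have "\<dots> = (\<Sum>i\<in>UNIV. \<Sum>j\<in>UNIV. \<Sum>J\<in>?P. x $ i * x $ j * (?Bx J * b J i j))"
      by (intro sum.cong refl sum.swap)
    also have "\<dots> = mpoly_eval h x"
      by (simp only: h Feq sum_distrib_left)
    finally show "mpoly_eval h x = mpoly_eval (\<Sum>J\<in>?P. ?B J * s J) x" ..
  qed
  have U: "U i \<in> T" for i
    unfolding U_def using \<open>R > 0\<close> by (intro mult_closed lower preordering_const_mem[OF T]) simp
  have U': "1 - U i \<in> T" for i
  proof -
    have "1 - U i = mpoly_const (1 / (2 * R)) * (mpoly_const R - mpoly_var i)"
      by (rule mpoly_eval_inject) (use \<open>R > 0\<close> in \<open>simp add: U_def field_simps\<close>)
    then show ?thesis
      using \<open>R > 0\<close> by (auto intro!: mult_closed upper preordering_const_mem[OF T])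
  qed
  show ?thesis
    unfolding h_eq
  proof (rule sum_mem)
    fix J assume "J \<in> ?P"
    show "?B J * s J \<in> T"
    proof (rule mult_closed)
      show "?B J \<in> T"
        by (intro prod_mem mult_closed power_mem U U' preordering_const_mem[OF T]) simp
      show "s J \<in> T"
        by (rule preordering_sos_subset[OF T s(1)]) fact
    qed
  qed
qed

subsection \<open>Total preorderings\<close>

text \<open>In a product the term with \<open>p ^ 2\<close> is absorbed into the first coefficient,
  a square being in \<open>T\<close>; so two coefficients always suffice.\<close>

lemma preordering_adjoin:
  assumes "preordering T" shows "preordering {a + b * p | a b. a \<in> T \<and> b \<in> T}" (is "preordering ?S")
proof -
  interpret preordering T by (rule assms)
  show ?thesis
  proof
    fix x y assume "x \<in> ?S" "y \<in> ?S"
    then obtain a b c d where *: "a \<in> T" "b \<in> T" "c \<in> T" "d \<in> T" "x = a + b * p" "y = c + d * p" by blast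
    have "x + y = (a + c) + (b + d) * p" by (simp add: * algebra_simps)
    then show "x + y \<in> ?S" using * add_closed by blast
    have "x * y = (a * c + b * d * p ^ 2) + (a * d + b * c) * p"
      by (simp add: * algebra_simps power2_eq_square)
    moreover have "a * c + b * d * p ^ 2 \<in> T" "a * d + b * c \<in> T"
      using * by (auto intro!: add_closed mult_closed square_mem)
    ultimately show "x * y \<in> ?S" by blast
  next
    fix x show "x ^ 2 \<in> ?S"
      using square_mem[of x] zero_mem by force
  qed
qed

lemma adjoin_memI: "preordering T \<Longrightarrow> a \<in> T \<Longrightarrow> a \<in> {a + b * p | a b. a \<in> T \<and> b \<in> T}"
  using preordering.zero_mem by force

lemma adjoin_generator_mem: "preordering T \<Longrightarrow> p \<in> {a + b * p | a b. a \<in> T \<and> b \<in> T}"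
  using preordering.zero_mem preordering.one_mem by force

text \<open>Take a maximal proper extension. If neither \<open>p\<close> nor \<open>- p\<close>
  belonged to it, adjoining either would produce -1, giving 1 + a = -b p and 1 + c = d p;
  multiplying these relations puts -1 into the extension itself.\<close>

lemma preordering_extend_total:
  fixes T :: "'a::comm_ring_1 set"
  assumes T: "preordering T" and "- 1 \<notin> T"
  obtains P where "preordering P" "T \<subseteq> P" "- 1 \<notin> P" "\<And>a. a \<in> P \<or> - a \<in> P"
proof -
  let ?A = "{P. preordering P \<and> T \<subseteq> P \<and> - 1 \<notin> P}"
  have "\<exists>P\<in>?A. \<forall>X\<in>?A. P \<subseteq> X \<longrightarrow> X = P"
  proof (rule subset_Zorn_nonempty)
    show "?A \<noteq> {}" using assms by blast
    fix C assume C: "C \<noteq> {}" "subset.chain ?A C"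
    have *: "\<exists>X\<in>C. a \<in> X \<and> b \<in> X" if "a \<in> \<Union>C" "b \<in> \<Union>C" for a b
      using that C(2) unfolding subset_chain_def by blast
    have "preordering (\<Union>C)"
    proof
      fix a b assume "a \<in> \<Union>C" "b \<in> \<Union>C"
      then obtain X where X: "X \<in> C" "a \<in> X" "b \<in> X" using * by blast
      then have "preordering X" using C(2) by (auto simp: subset_chain_def)
      then show "a + b \<in> \<Union>C" "a * b \<in> \<Union>C"
        using X preordering.add_closed preordering.mult_closed by blast+
    next
      fix a
      obtain X where X: "X \<in> C" using C(1) by blast
      then have "preordering X" using C(2) by (auto simp: subset_chain_def)
      then show "a ^ 2 \<in> \<Union>C" using X preordering.square_mem by blast
    qed
    then show "\<Union>C \<in> ?A" using C by (auto simp: subset_chain_def)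
  qed
  then obtain P where P: "preordering P" "T \<subseteq> P" "- 1 \<notin> P"
    and max: "\<And>X. preordering X \<Longrightarrow> - 1 \<notin> X \<Longrightarrow> P \<subseteq> X \<Longrightarrow> X = P" by fastforce
  interpret preordering P by (rule P)
  have adjoin: "- 1 \<in> {a + b * p | a b. a \<in> P \<and> b \<in> P}" if "p \<notin> P" for p
    using max[OF preordering_adjoin[OF P(1), of p]] adjoin_generator_mem[OF P(1), of p] that
      adjoin_memI[OF P(1), of _ p] by blast
  show ?thesis
  proof (rule that[OF P], rule ccontr)
    fix p assume "\<not> (p \<in> P \<or> - p \<in> P)"
    then obtain a b c d where *: "a \<in> P" "b \<in> P" "c \<in> P" "d \<in> P" "- 1 = a + b * p" "- 1 = c + d * - p"
      using adjoin[of p] adjoin[of "- p"] by blast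
    have "1 + a = 1 + (a + b * p) - b * p" "1 + c = 1 + (c + d * - p) + d * p" by simp_all
    then have "1 + a = - (b * p)" "1 + c = d * p" unfolding *(5,6)[symmetric] by simp_all
    then have "(1 + a) * (1 + c) = - (b * d * p ^ 2)"
      by (simp add: power2_eq_square mult_ac)
    moreover have "a + c + a * c + b * d * p ^ 2 = (1 + a) * (1 + c) - 1 + b * d * p ^ 2"
      by (simp add: algebra_simps)
    ultimately have "- 1 = a + c + a * c + b * d * p ^ 2" by simp
    moreover have "a + c + a * c + b * d * p ^ 2 \<in> P"
      using * by (auto intro!: add_closed mult_closed square_mem)
    ultimately show False using P(3) by simp
  qed
qed

subsection \<open>Bounded elements\<close>

definition preordering_bounded :: "'n::finite real_mpoly set \<Rightarrow> 'n real_mpoly \<Rightarrow> bool" where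
  "preordering_bounded T a \<longleftrightarrow> (\<exists>N. mpoly_const N - a \<in> T \<and> mpoly_const N + a \<in> T)"

lemma preordering_bounded_const:
  assumes "preordering T" shows "preordering_bounded T (mpoly_const c)"
  unfolding preordering_bounded_def
  by (rule exI[of _ "\<bar>c\<bar>"])
     (auto simp flip: mpoly_const_diff mpoly_const_add intro!: preordering_const_mem[OF assms])

lemma preordering_bounded_add:
  assumes T: "preordering T" and "preordering_bounded T a" "preordering_bounded T b"
  shows "preordering_bounded T (a + b)"
proof -
  interpret preordering T by (rule T)
  obtain N M where *: "mpoly_const N - a \<in> T" "mpoly_const N + a \<in> T" "mpoly_const M - b \<in> T" "mpoly_const M + b \<in> T"
    using assms by (auto simp: preordering_bounded_def)
  show ?thesis
    unfolding preordering_bounded_def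
    using add_closed[OF *(1,3)] add_closed[OF *(2,4)]
    by (intro exI[of _ "N + M"]) (simp add: mpoly_const_add algebra_simps)
qed

lemma preordering_bounded_mult:
  fixes a b :: "'n::finite real_mpoly"
  assumes T: "preordering T" and "preordering_bounded T a" "preordering_bounded T b"
  shows "preordering_bounded T (a * b)"
proof -
  interpret preordering T by (rule T)
  obtain N M where *: "mpoly_const N - a \<in> T" "mpoly_const N + a \<in> T" "mpoly_const M - b \<in> T" "mpoly_const M + b \<in> T"
    using assms by (auto simp: preordering_bounded_def)
  have "mpoly_const (N * M) - a * b =
      mpoly_const (1/2) * ((mpoly_const N - a) * (mpoly_const M + b) + (mpoly_const N + a) * (mpoly_const M - b))"
    by (rule mpoly_eval_inject) (simp add: field_simps)
  moreover have "mpoly_const (N * M) + a * b =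
      mpoly_const (1/2) * ((mpoly_const N - a) * (mpoly_const M - b) + (mpoly_const N + a) * (mpoly_const M + b))"
    by (rule mpoly_eval_inject) (simp add: field_simps)
  ultimately show ?thesis
    unfolding preordering_bounded_def
    by (intro exI[of _ "N * M"]) (simp add: * add_closed mult_closed preordering_const_mem[OF T])
qed

text \<open>Bounded elements form a ring containing the constants, so bounding the variables is
  enough.\<close>

lemma preordering_bounded_all:
  assumes T: "preordering T" and "\<And>i. preordering_bounded T (mpoly_var i)"
  shows "preordering_bounded T (p :: 'n::finite real_mpoly)"
proof -
  have 0: "preordering_bounded T 0" and 1: "preordering_bounded T 1"
    using preordering_bounded_const[OF T, of 0] preordering_bounded_const[OF T, of 1]
    by (simp_all add: mpoly_const_0 mpoly_const_1)
  have sum: "preordering_bounded T (\<Sum>i\<in>I. q i)" if "\<And>i. i \<in> I \<Longrightarrow> preordering_bounded T (q i)" for I :: "'b set" and q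
    using that by (induction I rule: infinite_finite_induct) (auto intro: preordering_bounded_add[OF T] 0)
  have prod: "preordering_bounded T (\<Prod>i\<in>I. q i)" if "\<And>i. i \<in> I \<Longrightarrow> preordering_bounded T (q i)" for I :: "'c set" and q
    using that by (induction I rule: infinite_finite_induct) (auto intro: preordering_bounded_mult[OF T] 1)
  have pow: "preordering_bounded T (q ^ k)" if "preordering_bounded T q" for q k
    using that by (induction k) (auto intro: preordering_bounded_mult[OF T] 1)
  have "preordering_bounded T (mpoly_subst mpoly_var p)"
    unfolding mpoly_subst_def
    by (intro sum prod pow preordering_bounded_mult[OF T] preordering_bounded_const[OF T] assms(2))
  then show ?thesis by (simp only: mpoly_subst_var)
qed

section \<open>Bounds on power sums of the variables\<close>

definition power_sum :: "('n \<Rightarrow> nat) \<Rightarrow> 'n::finite real_mpoly" where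
  "power_sum K = (\<Sum>i\<in>UNIV. mpoly_var i ^ K i)"

lemma even_power_mem:
  assumes "preordering T" "even k" shows "a ^ k \<in> T"
  using assms preordering.square_mem[OF assms(1), of "a ^ (k div 2)"]
  by (metis dvd_div_mult_self power_mult)

lemma power_sum_minus_mem:
  assumes T: "preordering T" and "\<And>i. even (K i)"
  shows "power_sum K - mpoly_var i ^ K i \<in> T"
proof -
  have "power_sum K - mpoly_var i ^ K i = (\<Sum>j\<in>UNIV-{i}. mpoly_var j ^ K j)"
    unfolding power_sum_def by (subst sum.remove[where A = UNIV and x = i]) auto
  then show ?thesis
    by (simp only:) (intro preordering.sum_mem[OF T] even_power_mem[OF T] assms(2))
qed

text \<open>Bernoulli's inequality with a certificate, the induction step adding a multiple of (u -
  1)^2. It brings a bound on a power down to a bound on the base.\<close>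

lemma tangent_power_mem:
  assumes T: "preordering T" and "u \<in> T"
  shows "u ^ k - 1 - of_nat k * (u - 1) \<in> T"
proof (induction k)
  case 0 then show ?case using preordering.zero_mem[OF T] by simp
next
  case (Suc k)
  interpret preordering T by (rule T)
  have "of_nat j \<in> T" for j by (induction j) (auto intro: add_closed zero_mem one_mem)
  moreover have "u ^ Suc k - 1 - of_nat (Suc k) * (u - 1) =
      u * (u ^ k - 1 - of_nat k * (u - 1)) + of_nat k * (u - 1) ^ 2"
    by (simp add: algebra_simps power2_eq_square)
  ultimately show ?case
    using Suc assms by (auto intro!: add_closed mult_closed square_mem)
qed

text \<open>Discarding the other even powers bounds one power of x_i, Bernoulli's inequality bounds
  x_i^2, and a completed square bounds x_i on both sides.\<close>

lemma var_bounded_if_power_sum_bounded: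
  fixes T :: "'n::finite real_mpoly set"
  assumes T: "preordering T" and K: "\<And>i. even (K i)" "\<And>i. K i > 0"
    and N: "mpoly_const N - power_sum K \<in> T"
  shows "preordering_bounded T (mpoly_var i)"
proof -
  interpret preordering T by (rule T)
  obtain k where k: "K i = 2 * k" "k > 0" using K by (metis dvdE zero_less_mult_pos zero_less_numeral)
  let ?x = "mpoly_var i :: 'n real_mpoly"
  have 1: "mpoly_const N - (?x ^ 2) ^ k \<in> T"
    using add_closed[OF N power_sum_minus_mem[of T K i, OF T K(1)]] by (simp add: k power_mult)
  \<comment> \<open>The solution of k(N' - 1) = N - 1, which is what the tangent of u^k at 1
    yields.\<close>
  define N' where "N' = (N + real k - 1) / real k"
  have "mpoly_const N' - ?x ^ 2 = mpoly_const (1 / real k) *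
      ((mpoly_const N - (?x ^ 2) ^ k) + ((?x ^ 2) ^ k - 1 - of_nat k * (?x ^ 2 - 1)))"
    by (rule mpoly_eval_inject) (use k(2) in \<open>simp add: N'_def mpoly_eval_of_nat field_simps\<close>)
  also have "\<dots> \<in> T"
    by (intro mult_closed add_closed 1 tangent_power_mem[OF T] square_mem preordering_const_mem[OF T]) simp
  finally have 2: "mpoly_const N' - ?x ^ 2 \<in> T" .
  have "mpoly_const (N' + 1/4) - ?x = (mpoly_const N' - ?x ^ 2) + (?x - mpoly_const (1/2)) ^ 2"
    "mpoly_const (N' + 1/4) + ?x = (mpoly_const N' - ?x ^ 2) + (?x + mpoly_const (1/2)) ^ 2"
    by (rule mpoly_eval_inject, simp add: power2_eq_square field_simps)+
  then show ?thesis
    unfolding preordering_bounded_def using 2 add_closed square_mem by metis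
qed

text \<open>Woermann's trick: \<open>1 + s\<close> is bounded with respect to the preordering obtained by adjoining
  \<open>N - \<rho>\<close>, and multiplication by \<open>1 + s\<close> moves \<open>N - \<rho>\<close> back into \<open>T\<close>.\<close>
lemma power_sum_bounded_if_multiple_bounded:
  fixes T :: "'n::finite real_mpoly set"
  assumes T: "preordering T" and K: "\<And>i. even (K i)" "\<And>i. K i > 0"
    and st: "s \<in> T" "t \<in> T" "t * (mpoly_const N - power_sum K) = 1 + s"
  shows "\<exists>N. mpoly_const N - power_sum K \<in> T"
proof -
  interpret preordering T by (rule T)
  let ?p = "mpoly_const N - power_sum K :: 'n real_mpoly"
  let ?T' = "{a + b * ?p | a b. a \<in> T \<and> b \<in> T}"
  have T': "preordering ?T'" by (rule preordering_adjoin[OF T])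
  have rho: "power_sum K \<in> T"
    unfolding power_sum_def by (intro sum_mem even_power_mem[OF T] K)
  define u where "u = 1 + s"
  have u: "u \<in> T" using st one_mem add_closed by (simp add: u_def)
  \<comment> \<open>Multiplying \<open>t * ?p = u\<close> by \<open>?p\<close> turns the left side
    into \<open>t\<close> times a square.\<close>
  have up: "u * ?p \<in> T"
  proof -
    have "u * ?p = t * ?p ^ 2" by (simp only: u_def st(3)[symmetric] power2_eq_square mult.assoc)
    then show ?thesis using st mult_closed square_mem by metis
  qed
  have "preordering_bounded ?T' u"
    by (rule preordering_bounded_all[OF T'],
        rule var_bounded_if_power_sum_bounded[of _ K, OF T' K adjoin_generator_mem[OF T]])
  then obtain M0 where "mpoly_const M0 - u \<in> ?T'" by (auto simp: preordering_bounded_def)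
  moreover have "mpoly_const (\<bar>M0\<bar> + 1 - M0) \<in> ?T'" by (rule preordering_const_mem[OF T']) simp
  ultimately have "mpoly_const M0 - u + mpoly_const (\<bar>M0\<bar> + 1 - M0) \<in> ?T'"
    by (rule preordering.add_closed[OF T'])
  moreover define M where "M = \<bar>M0\<bar> + 1"
  moreover have "mpoly_const M0 - u + mpoly_const (\<bar>M0\<bar> + 1 - M0) = mpoly_const M - u"
    by (rule mpoly_eval_inject) (simp add: M_def)
  ultimately obtain a b where ab: "a \<in> T" "b \<in> T" "mpoly_const M - u = a + b * ?p" by auto
  have "M > 0" by (simp add: M_def)
  \<comment> \<open>\<open>?p\<close> need not lie in \<open>T\<close>, but \<open>u * ?p\<close>
    does; multiplying by \<open>u\<close> thus returns from \<open>?T'\<close> to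
    \<open>T\<close>.\<close>
  have "u * (mpoly_const M - u) = u * a + b * (u * ?p)"
    unfolding ab(3) by (simp add: algebra_simps)
  then have uMu: "u * (mpoly_const M - u) \<in> T" using ab u up by (metis add_closed mult_closed)
  have "mpoly_const M - u = mpoly_const (1 / M) * ((mpoly_const M - u) ^ 2 + u * (mpoly_const M - u))"
    by (rule mpoly_eval_inject) (use \<open>M > 0\<close> in \<open>simp add: field_simps power2_eq_square\<close>)
  then have Mu: "mpoly_const M - u \<in> T"
    using uMu \<open>M > 0\<close> by (metis add_closed mult_closed square_mem preordering_const_mem[OF T]
        divide_nonneg_nonneg less_imp_le zero_le_one)
  \<comment> \<open>Expanding \<open>u * ?p\<close> leaves a surplus \<open>s * power_sum K\<close>,
    which is restored by a member of \<open>T\<close>; the last summand handles negative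
    \<open>N\<close>.\<close>
  have "mpoly_const (\<bar>N\<bar> * M) - power_sum K =
      mpoly_const \<bar>N\<bar> * (mpoly_const M - u) + (u * ?p + s * power_sum K + mpoly_const (\<bar>N\<bar> - N) * u)"
    by (rule mpoly_eval_inject) (simp add: u_def algebra_simps)
  also have "\<dots> \<in> T"
    by (intro add_closed mult_closed preordering_const_mem[OF T] Mu up st rho u) auto
  finally show ?thesis ..
qed

text \<open>Adjoining \<open>power_sum K - N\<close> gives preorderings that increase with
  \<open>N\<close>, so their union is one too. If -1 were in the union, some multiple of
  \<open>N - power_sum K\<close> would equal 1 plus an element of \<open>T\<close>, and
  \<open>power_sum_bounded_if_multiple_bounded\<close> would bound the power sum.\<close>

lemma unbounded_total_preordering:
  fixes T :: "'n::finite real_mpoly set"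
  assumes T: "preordering T" and K: "\<And>i. even (K i)" "\<And>i. K i > 0"
    and unb: "\<And>N. mpoly_const N - power_sum K \<notin> T"
  obtains P where "preordering P" "T \<subseteq> P" "- 1 \<notin> P" "\<And>a. a \<in> P \<or> - a \<in> P"
    "\<And>N. power_sum K - mpoly_const N \<in> P"
proof -
  interpret preordering T by (rule T)
  define S where "S = (\<lambda>N. {a + b * (power_sum K - mpoly_const N) | a b. a \<in> T \<and> b \<in> T})"
  have S: "preordering (S N)" for N unfolding S_def by (rule preordering_adjoin[OF T])
  have mono: "S N \<subseteq> S M" if "N \<le> M" for N M
  proof
    fix x assume "x \<in> S N"
    then obtain a b where ab: "a \<in> T" "b \<in> T" "x = a + b * (power_sum K - mpoly_const N)" by (auto simp: S_def)
    have "x = (a + b * mpoly_const (M - N)) + b * (power_sum K - mpoly_const M)"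
      unfolding ab(3) by (rule mpoly_eval_inject) (simp add: algebra_simps)
    moreover have "a + b * mpoly_const (M - N) \<in> T"
      using ab that by (intro add_closed mult_closed preordering_const_mem[OF T]) auto
    ultimately show "x \<in> S M" using ab(2) unfolding S_def by blast
  qed
  have "preordering (\<Union>N. S N)"
  proof
    fix a b assume "a \<in> (\<Union>N. S N)" "b \<in> (\<Union>N. S N)"
    then obtain N M where "a \<in> S N" "b \<in> S M" by blast
    then have *: "a \<in> S (max N M)" "b \<in> S (max N M)"
      using mono[OF max.cobounded1[of N M]] mono[OF max.cobounded2[of M N]] by auto
    show "a + b \<in> (\<Union>N. S N)" "a * b \<in> (\<Union>N. S N)"
      using preordering.add_closed[OF S *] preordering.mult_closed[OF S *] by blast+
  next
    fix a show "a ^ 2 \<in> (\<Union>N. S N)" using preordering.square_mem[OF S] by blast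
  qed
  moreover have "- 1 \<notin> (\<Union>N. S N)"
  proof
    assume "- 1 \<in> (\<Union>N. S N)"
    then obtain N a b where ab: "a \<in> T" "b \<in> T" "- 1 = a + b * (power_sum K - mpoly_const N)"
      by (auto simp: S_def)
    have "b * (mpoly_const N - power_sum K) = a - (a + b * (power_sum K - mpoly_const N))"
      by (simp add: algebra_simps)
    also have "\<dots> = 1 + a" by (simp add: ab(3)[symmetric])
    finally have "b * (mpoly_const N - power_sum K) = 1 + a" .
    from power_sum_bounded_if_multiple_bounded[of T K, OF T K ab(1,2) this] unb show False by blast
  qed
  ultimately obtain P where P: "preordering P" "(\<Union>N. S N) \<subseteq> P" "- 1 \<notin> P" "\<And>a. a \<in> P \<or> - a \<in> P"
    using preordering_extend_total by blast
  show ?thesis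
  proof (rule that[OF P(1) _ P(3,4)])
    show "T \<subseteq> P" using P(2) adjoin_memI[OF T] by (fastforce simp: S_def)
    show "power_sum K - mpoly_const N \<in> P" for N
      using P(2) adjoin_generator_mem[OF T, of "power_sum K - mpoly_const N"] by (auto simp: S_def)
  qed
qed

subsection \<open>Leading coefficients with respect to an infinitely large element\<close>

text \<open>Read \<open>b - a \<in> P\<close> as a comparison of \<open>a\<close> with
  \<open>b\<close>. It is total, but nonzero \<open>a\<close> may lie in \<open>P\<close> together
  with \<open>- a\<close>. The element \<open>\<rho>\<close> lies above every real constant.\<close>

locale infinite_ordering = preordering P for P :: "'n::finite real_mpoly set" +
  fixes \<rho> :: "'n real_mpoly"
  assumes total: "a \<in> P \<or> - a \<in> P"
    and minus_one: "- 1 \<notin> P"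
    and infinite: "\<rho> - mpoly_const N \<in> P"
begin

lemma preord: "preordering P"
  by (rule preordering_axioms)

lemma const_mem: "c \<ge> 0 \<Longrightarrow> mpoly_const c \<in> P"
  by (rule preordering_const_mem[OF preord])

lemma const_neg: "c < 0 \<Longrightarrow> mpoly_const c \<notin> P"
proof
  assume "c < 0" "mpoly_const c \<in> P"
  then have "mpoly_const (- (1 / c)) * mpoly_const c \<in> P"
    by (intro mult_closed[OF const_mem]) (auto simp: divide_le_0_iff)
  also have "mpoly_const (- (1 / c)) * mpoly_const c = (- 1 :: 'n real_mpoly)"
    by (rule mpoly_eval_inject) (use \<open>c < 0\<close> in simp)
  finally show False using minus_one by simp
qed

lemma rho_mem: "\<rho> \<in> P"
  using infinite[of 0] by (simp add: mpoly_const_0)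

lemma diff_trans: "b - a \<in> P \<Longrightarrow> c - b \<in> P \<Longrightarrow> c - a \<in> P"
  using add_closed[of "b - a" "c - b"] by simp

lemma power_mono_mem:
  assumes "a \<in> P" "b - a \<in> P" shows "b ^ k - a ^ k \<in> P"
proof (induction k)
  case (Suc k)
  have "b \<in> P" using add_closed[OF assms] by simp
  have "b ^ Suc k - a ^ Suc k = b ^ k * (b - a) + a * (b ^ k - a ^ k)"
    by (simp add: algebra_simps)
  then show ?case
    using Suc assms \<open>b \<in> P\<close> by (auto intro!: add_closed mult_closed power_mem)
qed (simp add: zero_mem)

lemma rho_power_ge_1: "\<rho> ^ k - 1 \<in> P"
  using power_mono_mem[OF one_mem, of \<rho> k] infinite[of 1] by (simp add: mpoly_const_1)

lemma const_mult_rho_power_neg: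
  assumes "c < 0" shows "mpoly_const c * \<rho> ^ k \<notin> P"
proof
  assume "mpoly_const c * \<rho> ^ k \<in> P"
  then have "mpoly_const c * \<rho> ^ k + mpoly_const (- c) * (\<rho> ^ k - 1) \<in> P"
    by (rule add_closed) (use assms in \<open>auto intro!: mult_closed const_mem rho_power_ge_1\<close>)
  also have "mpoly_const c * \<rho> ^ k + mpoly_const (- c) * (\<rho> ^ k - 1) = mpoly_const c"
    by (rule mpoly_eval_inject) (simp add: algebra_simps)
  finally show False using const_neg[OF assms] by simp
qed

lemma rho_const_mult_le:
  assumes "mpoly_const c * \<rho> ^ k - a \<in> P" "a - mpoly_const c' * \<rho> ^ k \<in> P" shows "c' \<le> c"
proof (rule ccontr)
  assume "\<not> c' \<le> c"
  have "mpoly_const c * \<rho> ^ k - mpoly_const c' * \<rho> ^ k \<in> P" by (rule diff_trans[OF assms(2,1)])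
  also have "mpoly_const c * \<rho> ^ k - mpoly_const c' * \<rho> ^ k = mpoly_const (c - c') * \<rho> ^ k"
    by (simp add: mpoly_const_diff algebra_simps)
  finally show False using const_mult_rho_power_neg[of "c - c'" k] \<open>\<not> c' \<le> c\<close> by simp
qed

text \<open>Says that \<open>a / \<rho> ^ e\<close> is infinitely close to the real
  \<open>r\<close>, without dividing. As \<open>r\<close> may be 0, \<open>e\<close> is only an
  upper bound for the order of growth.\<close>

definition asymp :: "nat \<Rightarrow> 'n real_mpoly \<Rightarrow> real \<Rightarrow> bool" where
  "asymp e a r \<longleftrightarrow> (\<forall>\<epsilon>>0. a - mpoly_const (r - \<epsilon>) * \<rho> ^ e \<in> P \<and> mpoly_const (r + \<epsilon>) * \<rho> ^ e - a \<in> P)"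

lemma asympD:
  assumes "asymp e a r"
  shows "c < r \<Longrightarrow> a - mpoly_const c * \<rho> ^ e \<in> P" "c > r \<Longrightarrow> mpoly_const c * \<rho> ^ e - a \<in> P"
  using assms[unfolded asymp_def, rule_format, of "r - c"]
    assms[unfolded asymp_def, rule_format, of "c - r"] by simp_all

lemma asymp_zero: "asymp e 0 0"
  unfolding asymp_def
proof (intro allI impI conjI)
  fix \<epsilon> :: real assume "\<epsilon> > 0"
  have "mpoly_const \<epsilon> * \<rho> ^ e \<in> P" using \<open>\<epsilon> > 0\<close> by (intro mult_closed const_mem power_mem rho_mem) auto
  moreover have "0 - mpoly_const (0 - \<epsilon>) * \<rho> ^ e = mpoly_const \<epsilon> * \<rho> ^ e"
    by (rule mpoly_eval_inject) simp
  ultimately show "0 - mpoly_const (0 - \<epsilon>) * \<rho> ^ e \<in> P" "mpoly_const (0 + \<epsilon>) * \<rho> ^ e - 0 \<in> P" by simp_all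
qed

lemma asymp_add:
  assumes "asymp e a r" "asymp e b s" shows "asymp e (a + b) (r + s)"
  unfolding asymp_def
proof (intro allI impI conjI)
  fix \<epsilon> :: real assume \<epsilon>: "\<epsilon> > 0"
  have eq: "a + b - mpoly_const (r + s - \<epsilon>) * \<rho> ^ e =
      (a - mpoly_const (r - \<epsilon> / 2) * \<rho> ^ e) + (b - mpoly_const (s - \<epsilon> / 2) * \<rho> ^ e)"
    "mpoly_const (r + s + \<epsilon>) * \<rho> ^ e - (a + b) =
      (mpoly_const (r + \<epsilon> / 2) * \<rho> ^ e - a) + (mpoly_const (s + \<epsilon> / 2) * \<rho> ^ e - b)"
    by (rule mpoly_eval_inject, simp add: field_simps)+
  show "a + b - mpoly_const (r + s - \<epsilon>) * \<rho> ^ e \<in> P" "mpoly_const (r + s + \<epsilon>) * \<rho> ^ e - (a + b) \<in> P"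
    unfolding eq using \<epsilon> by (auto intro!: add_closed asympD[OF assms(1)] asympD[OF assms(2)])
qed

lemma asymp_const_mult:
  assumes "asymp e a r" shows "asymp e (mpoly_const c * a) (c * r)"
proof (cases "c = 0")
  case False
  show ?thesis
    unfolding asymp_def
  proof (intro allI impI conjI)
    fix \<epsilon> :: real assume "\<epsilon> > 0"
    define \<delta> where "\<delta> = \<epsilon> / \<bar>c\<bar>"
    have \<delta>: "\<delta> > 0" "\<bar>c\<bar> * \<delta> = \<epsilon>" using \<open>\<epsilon> > 0\<close> False by (auto simp: \<delta>_def)
    have *: "mpoly_const \<bar>c\<bar> * (a - mpoly_const (r - \<delta>) * \<rho> ^ e) \<in> P"
      "mpoly_const \<bar>c\<bar> * (mpoly_const (r + \<delta>) * \<rho> ^ e - a) \<in> P"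
      using \<delta>(1) by (auto intro!: mult_closed const_mem asympD[OF assms])
    show "mpoly_const c * a - mpoly_const (c * r - \<epsilon>) * \<rho> ^ e \<in> P"
    proof (cases "c > 0")
      case True
      have "mpoly_const c * a - mpoly_const (c * r - \<epsilon>) * \<rho> ^ e = mpoly_const \<bar>c\<bar> * (a - mpoly_const (r - \<delta>) * \<rho> ^ e)"
        by (rule mpoly_eval_inject) (use True in \<open>simp add: \<delta>(2)[symmetric] algebra_simps\<close>)
      with * show ?thesis by simp
    next
      case False
      have "mpoly_const c * a - mpoly_const (c * r - \<epsilon>) * \<rho> ^ e = mpoly_const \<bar>c\<bar> * (mpoly_const (r + \<delta>) * \<rho> ^ e - a)"
        by (rule mpoly_eval_inject) (use False in \<open>simp add: \<delta>(2)[symmetric] algebra_simps\<close>)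
      with * show ?thesis by simp
    qed
    show "mpoly_const (c * r + \<epsilon>) * \<rho> ^ e - mpoly_const c * a \<in> P"
    proof (cases "c > 0")
      case True
      have "mpoly_const (c * r + \<epsilon>) * \<rho> ^ e - mpoly_const c * a = mpoly_const \<bar>c\<bar> * (mpoly_const (r + \<delta>) * \<rho> ^ e - a)"
        by (rule mpoly_eval_inject) (use True in \<open>simp add: \<delta>(2)[symmetric] algebra_simps\<close>)
      with * show ?thesis by simp
    next
      case False
      have "mpoly_const (c * r + \<epsilon>) * \<rho> ^ e - mpoly_const c * a = mpoly_const \<bar>c\<bar> * (a - mpoly_const (r - \<delta>) * \<rho> ^ e)"
        by (rule mpoly_eval_inject) (use False in \<open>simp add: \<delta>(2)[symmetric] algebra_simps\<close>)
      with * show ?thesis by simp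
    qed
  qed
qed (simp add: asymp_zero mpoly_const_0)

lemma asymp_sum:
  "(\<And>i. i \<in> I \<Longrightarrow> asymp e (a i) (r i)) \<Longrightarrow> asymp e (\<Sum>i\<in>I. a i) (\<Sum>i\<in>I. r i)"
  by (induction I rule: infinite_finite_induct) (auto intro: asymp_add asymp_zero)

lemma asymp_one: "asymp 0 1 1"
  unfolding asymp_def
proof (intro allI impI conjI)
  fix \<epsilon> :: real assume "\<epsilon> > 0"
  have "1 - mpoly_const (1 - \<epsilon>) * \<rho> ^ 0 = mpoly_const \<epsilon>" "mpoly_const (1 + \<epsilon>) * \<rho> ^ 0 - 1 = mpoly_const \<epsilon>"
    by (rule mpoly_eval_inject, simp)+
  then show "1 - mpoly_const (1 - \<epsilon>) * \<rho> ^ 0 \<in> P" "mpoly_const (1 + \<epsilon>) * \<rho> ^ 0 - 1 \<in> P"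
    using const_mem[of \<epsilon>] \<open>\<epsilon> > 0\<close> by simp_all
qed

lemma mult_mono_mem:
  assumes "a' \<in> P" "b' \<in> P" "a - a' \<in> P" "b - b' \<in> P"
  shows "a * b - a' * b' \<in> P"
proof -
  have "b \<in> P" using add_closed[OF assms(2,4)] by simp
  have "a * b - a' * b' = (a - a') * b + a' * (b - b')" by (simp add: algebra_simps)
  then show ?thesis using assms \<open>b \<in> P\<close> by (auto intro!: add_closed mult_closed)
qed

text \<open>Inequalities may be multiplied only between nonnegative elements; the lower bounds are
  therefore cut off at 0 in \<open>r'\<close> and \<open>s'\<close>.\<close>

lemma asymp_mult:
  assumes ab: "a \<in> P" "b \<in> P" and rs: "r \<ge> 0" "s \<ge> 0" and A: "asymp e a r" "asymp e' b s"
  shows "asymp (e + e') (a * b) (r * s)"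
  unfolding asymp_def
proof (intro allI impI)
  fix \<epsilon> :: real assume \<epsilon>: "\<epsilon> > 0"
  \<comment> \<open>As \<open>\<delta>\<close> is at most 1, its square is at most
    \<open>\<delta>\<close>, so the errors above and below are both at most
    \<open>\<delta> * (r + s + 1)\<close>.\<close>
  define \<delta> where "\<delta> = min 1 (\<epsilon> / (r + s + 1))"
  have \<delta>: "\<delta> > 0" "\<delta> \<le> 1" using \<epsilon> rs by (auto simp: \<delta>_def)
  have "\<delta> \<le> \<epsilon> / (r + s + 1)" by (simp add: \<delta>_def)
  then have *: "\<delta> * (r + s + 1) \<le> \<epsilon>" using rs by (simp add: field_simps)
  have "\<delta> * \<delta> \<le> \<delta>" using \<delta> by (simp add: mult_left_le)
  define r' where "r' = max 0 (r - \<delta>)"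
  define s' where "s' = max 0 (s - \<delta>)"
  have upper: "(r + \<delta>) * (s + \<delta>) \<le> r * s + \<epsilon>"
    using * \<open>\<delta> * \<delta> \<le> \<delta>\<close> by (simp add: algebra_simps)
  have lower: "r * s - \<epsilon> \<le> r' * s'"
  proof -
    have "r * s - r' * s' = (r - r') * s + r' * (s - s')" by (simp add: algebra_simps)
    also have "\<dots> \<le> \<delta> * s + r * \<delta>"
      using rs \<delta> by (intro add_mono mult_mono) (auto simp: r'_def s'_def)
    also have "\<dots> \<le> \<epsilon>" using * \<delta> by (simp add: algebra_simps)
    finally show ?thesis by simp
  qed
  have a': "a - mpoly_const r' * \<rho> ^ e \<in> P"
    using asympD(1)[OF A(1), of "r - \<delta>"] ab \<delta> by (cases "r' = 0") (auto simp: r'_def max_def mpoly_const_0)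
  have b': "b - mpoly_const s' * \<rho> ^ e' \<in> P"
    using asympD(1)[OF A(2), of "s - \<delta>"] ab \<delta> by (cases "s' = 0") (auto simp: s'_def max_def mpoly_const_0)
  have pos: "mpoly_const c * \<rho> ^ k \<in> P" if "c \<ge> 0" for c k
    using that by (intro mult_closed const_mem power_mem rho_mem)
  have "a * b - (mpoly_const r' * \<rho> ^ e) * (mpoly_const s' * \<rho> ^ e') \<in> P"
    by (rule mult_mono_mem[OF pos pos a' b']) (auto simp: r'_def s'_def)
  moreover have "mpoly_const (r' * s' - (r * s - \<epsilon>)) * \<rho> ^ (e + e') \<in> P"
    by (rule pos) (use lower in simp)
  ultimately have "a * b - (mpoly_const r' * \<rho> ^ e) * (mpoly_const s' * \<rho> ^ e') +
      mpoly_const (r' * s' - (r * s - \<epsilon>)) * \<rho> ^ (e + e') \<in> P"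
    by (rule add_closed)
  also have "a * b - (mpoly_const r' * \<rho> ^ e) * (mpoly_const s' * \<rho> ^ e') +
      mpoly_const (r' * s' - (r * s - \<epsilon>)) * \<rho> ^ (e + e') = a * b - mpoly_const (r * s - \<epsilon>) * \<rho> ^ (e + e')"
    by (rule mpoly_eval_inject) (simp add: algebra_simps power_add)
  finally have 1: "a * b - mpoly_const (r * s - \<epsilon>) * \<rho> ^ (e + e') \<in> P" .
  have "(mpoly_const (r + \<delta>) * \<rho> ^ e) * (mpoly_const (s + \<delta>) * \<rho> ^ e') - a * b \<in> P"
    using \<delta> by (intro mult_mono_mem ab asympD(2)[OF A(1)] asympD(2)[OF A(2)]) auto
  moreover have "mpoly_const (r * s + \<epsilon> - (r + \<delta>) * (s + \<delta>)) * \<rho> ^ (e + e') \<in> P"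
    by (rule pos) (use upper in simp)
  ultimately have "(mpoly_const (r + \<delta>) * \<rho> ^ e) * (mpoly_const (s + \<delta>) * \<rho> ^ e') - a * b +
      mpoly_const (r * s + \<epsilon> - (r + \<delta>) * (s + \<delta>)) * \<rho> ^ (e + e') \<in> P"
    by (rule add_closed)
  also have "(mpoly_const (r + \<delta>) * \<rho> ^ e) * (mpoly_const (s + \<delta>) * \<rho> ^ e') - a * b +
      mpoly_const (r * s + \<epsilon> - (r + \<delta>) * (s + \<delta>)) * \<rho> ^ (e + e') =
      mpoly_const (r * s + \<epsilon>) * \<rho> ^ (e + e') - a * b"
    by (rule mpoly_eval_inject) (simp add: algebra_simps power_add)
  finally have 2: "mpoly_const (r * s + \<epsilon>) * \<rho> ^ (e + e') - a * b \<in> P" .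
  show "a * b - mpoly_const (r * s - \<epsilon>) * \<rho> ^ (e + e') \<in> P \<and> mpoly_const (r * s + \<epsilon>) * \<rho> ^ (e + e') - a * b \<in> P"
    using 1 2 by blast
qed

lemma asymp_power:
  assumes "a \<in> P" "r \<ge> 0" "asymp e a r" shows "asymp (e * k) (a ^ k) (r ^ k)"
proof (induction k)
  case 0 show ?case using asymp_one by simp
next
  case (Suc k)
  have "asymp (e + e * k) (a * a ^ k) (r * r ^ k)"
    using assms Suc by (intro asymp_mult power_mem) auto
  then show ?case by simp
qed

lemma asymp_prod:
  assumes "finite I" "\<And>i. i \<in> I \<Longrightarrow> a i \<in> P" "\<And>i. i \<in> I \<Longrightarrow> r i \<ge> 0"
    "\<And>i. i \<in> I \<Longrightarrow> asymp (e i) (a i) (r i)"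
  shows "asymp (\<Sum>i\<in>I. e i) (\<Prod>i\<in>I. a i) (\<Prod>i\<in>I. r i)"
  using assms
proof (induction I rule: finite_induct)
  case empty then show ?case using asymp_one by simp
next
  case (insert i I)
  then have "asymp (e i + (\<Sum>i\<in>I. e i)) (a i * (\<Prod>i\<in>I. a i)) (r i * (\<Prod>i\<in>I. r i))"
    by (intro asymp_mult prod_mem prod_nonneg) auto
  with insert show ?case by simp
qed

lemma asymp_negligible:
  assumes "a \<in> P" "asymp e a r" "e < e'" shows "asymp e' a 0"
  unfolding asymp_def
proof (intro allI impI conjI)
  fix \<epsilon> :: real assume \<epsilon>: "\<epsilon> > 0"
  have "a + mpoly_const \<epsilon> * \<rho> ^ e' \<in> P"
    using \<epsilon> assms(1) by (intro add_closed mult_closed const_mem power_mem rho_mem) auto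
  also have "a + mpoly_const \<epsilon> * \<rho> ^ e' = a - mpoly_const (0 - \<epsilon>) * \<rho> ^ e'"
    by (rule mpoly_eval_inject) simp
  finally show "a - mpoly_const (0 - \<epsilon>) * \<rho> ^ e' \<in> P" .
  obtain k where k: "e' = e + Suc k" using assms(3) less_iff_Suc_add by auto
  \<comment> \<open>Once \<open>\<rho>\<close> exceeds \<open>c\<close>, the product of
    \<open>\<epsilon>\<close> and \<open>\<rho>\<close> exceeds \<open>r + 1\<close>, the upper
    constant available for \<open>a\<close>.\<close>
  define c where "c = (r + 1) / \<epsilon>"
  have c: "r = \<epsilon> * c - 1" using \<epsilon> by (simp add: c_def)
  have "(mpoly_const (r + 1) * \<rho> ^ e - a) +
      mpoly_const \<epsilon> * \<rho> ^ e * (\<rho> * (\<rho> ^ k - 1) + (\<rho> - mpoly_const c)) \<in> P"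
    using \<epsilon> by (intro add_closed mult_closed const_mem power_mem rho_mem rho_power_ge_1 infinite asympD(2)[OF assms(2)]) auto
  also have "(mpoly_const (r + 1) * \<rho> ^ e - a) +
      mpoly_const \<epsilon> * \<rho> ^ e * (\<rho> * (\<rho> ^ k - 1) + (\<rho> - mpoly_const c)) = mpoly_const (0 + \<epsilon>) * \<rho> ^ e' - a"
    by (rule mpoly_eval_inject) (simp add: c k power_add algebra_simps)
  finally show "mpoly_const (0 + \<epsilon>) * \<rho> ^ e' - a \<in> P" .
qed

text \<open>By totality, a failed bound on \<open>y\<close> is the reverse bound; its m-th power
  contradicts the leading coefficient \<open>S\<close> of \<open>y ^ m\<close>.\<close>

lemma asymp_root:
  assumes y: "y \<in> P" and m: "m > 0" and R: "R \<ge> 0" "R ^ m = S" and A: "asymp m (y ^ m) S"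
  shows "asymp 1 y R"
  unfolding asymp_def
proof (intro allI impI conjI)
  fix \<epsilon> :: real assume \<epsilon>: "\<epsilon> > 0"
  have pow: "(mpoly_const c * \<rho>) ^ m = mpoly_const (c ^ m) * \<rho> ^ m" for c
    by (rule mpoly_eval_inject) (simp add: power_mult_distrib)
  have pos: "mpoly_const c * \<rho> \<in> P" if "c \<ge> 0" for c
    using that by (intro mult_closed const_mem rho_mem)
  show "mpoly_const (R + \<epsilon>) * \<rho> ^ 1 - y \<in> P"
  proof (rule ccontr)
    assume "mpoly_const (R + \<epsilon>) * \<rho> ^ 1 - y \<notin> P"
    then have "y - mpoly_const (R + \<epsilon>) * \<rho> \<in> P" using total[of "mpoly_const (R + \<epsilon>) * \<rho> - y"] by auto
    then have *: "y ^ m - mpoly_const ((R + \<epsilon>) ^ m) * \<rho> ^ m \<in> P"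
      unfolding pow[symmetric] using R \<epsilon> by (intro power_mono_mem pos) auto
    have "S < (R + \<epsilon>) ^ m" unfolding R(2)[symmetric] using R \<epsilon> m by (intro power_strict_mono) auto
    \<comment> \<open>The midpoint leaves a strict gap on both sides: \<open>asympD\<close> needs a
      constant above \<open>S\<close>, and \<open>rho_const_mult_le\<close> returns only a weak
      inequality.\<close>
    then have "mpoly_const ((S + (R + \<epsilon>) ^ m) / 2) * \<rho> ^ m - y ^ m \<in> P" by (intro asympD(2)[OF A]) simp
    from rho_const_mult_le[OF this *] \<open>S < (R + \<epsilon>) ^ m\<close> show False by simp
  qed
  show "y - mpoly_const (R - \<epsilon>) * \<rho> ^ 1 \<in> P"
  proof (cases "R - \<epsilon> < 0")
    case True
    have "y + mpoly_const (\<epsilon> - R) * \<rho> \<in> P" using True by (intro add_closed y pos) simp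
    also have "y + mpoly_const (\<epsilon> - R) * \<rho> = y - mpoly_const (R - \<epsilon>) * \<rho> ^ 1"
      by (rule mpoly_eval_inject) (simp add: algebra_simps)
    finally show ?thesis .
  next
    case False
    show ?thesis
    proof (rule ccontr)
      assume "y - mpoly_const (R - \<epsilon>) * \<rho> ^ 1 \<notin> P"
      then have "mpoly_const (R - \<epsilon>) * \<rho> - y \<in> P" using total[of "y - mpoly_const (R - \<epsilon>) * \<rho>"] by auto
      then have *: "mpoly_const ((R - \<epsilon>) ^ m) * \<rho> ^ m - y ^ m \<in> P"
        unfolding pow[symmetric] by (intro power_mono_mem y)
      have "(R - \<epsilon>) ^ m < S" unfolding R(2)[symmetric] using False \<epsilon> m by (intro power_strict_mono) auto
      then have "y ^ m - mpoly_const ((S + (R - \<epsilon>) ^ m) / 2) * \<rho> ^ m \<in> P" by (intro asympD(1)[OF A]) simp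
      from rho_const_mult_le[OF * this] \<open>(R - \<epsilon>) ^ m < S\<close> show False by simp
    qed
  qed
qed

text \<open>The standard part of \<open>a / \<rho>\<close> as the supremum of its real lower bounds:
  0 is one of them, and 1 bounds them all.\<close>

lemma asymp_exists:
  assumes "a \<in> P" "\<rho> - a \<in> P"
  shows "\<exists>r\<ge>0. asymp 1 a r"
proof -
  define S where "S = {r. a - mpoly_const r * \<rho> \<in> P}"
  have "0 \<in> S" using assms by (simp add: S_def mpoly_const_0)
  have le1: "r \<le> 1" if "r \<in> S" for r
    using rho_const_mult_le[of 1 1 a r] assms(2) that by (simp add: S_def mpoly_const_1)
  have bdd: "bdd_above S" using le1 by (auto simp: bdd_above_def)
  have "asymp 1 a (Sup S)"
    unfolding asymp_def power_one_right
  proof (intro allI impI conjI)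
    fix \<epsilon> :: real assume \<epsilon>: "\<epsilon> > 0"
    obtain r where r: "r \<in> S" "Sup S - \<epsilon> < r"
      using less_cSup_iff[OF _ bdd, of "Sup S - \<epsilon>"] \<open>0 \<in> S\<close> \<epsilon> by auto
    have "(a - mpoly_const r * \<rho>) + mpoly_const (r - (Sup S - \<epsilon>)) * \<rho> \<in> P"
      using r by (intro add_closed mult_closed const_mem rho_mem) (auto simp: S_def)
    also have "(a - mpoly_const r * \<rho>) + mpoly_const (r - (Sup S - \<epsilon>)) * \<rho> = a - mpoly_const (Sup S - \<epsilon>) * \<rho>"
      by (rule mpoly_eval_inject) (simp add: algebra_simps)
    finally show "a - mpoly_const (Sup S - \<epsilon>) * \<rho> \<in> P" .
    have "Sup S + \<epsilon> \<notin> S" using cSup_upper[OF _ bdd, of "Sup S + \<epsilon>"] \<epsilon> by auto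
    then show "mpoly_const (Sup S + \<epsilon>) * \<rho> - a \<in> P"
      using total[of "a - mpoly_const (Sup S + \<epsilon>) * \<rho>"] by (auto simp: S_def)
  qed
  moreover have "Sup S \<ge> 0" using cSup_upper[OF \<open>0 \<in> S\<close> bdd] .
  ultimately show ?thesis by blast
qed

end

section \<open>Weighted degrees and leading forms\<close>

definition monom_weight :: "('n \<Rightarrow> nat) \<Rightarrow> ('n::finite \<Rightarrow>\<^sub>0 nat) \<Rightarrow> nat" where
  "monom_weight W \<alpha> = (\<Sum>i\<in>UNIV. Poly_Mapping.lookup \<alpha> i * W i)"

definition weighted_form :: "('n \<Rightarrow> nat) \<Rightarrow> nat \<Rightarrow> 'n::finite real_mpoly \<Rightarrow> real ^ 'n \<Rightarrow> real" where
  "weighted_form W m p x =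
     (\<Sum>\<alpha>\<in>Poly_Mapping.keys p. if monom_weight W \<alpha> = m then Poly_Mapping.lookup p \<alpha> * monom_eval \<alpha> x else 0)"

text \<open>The variables, measured against powers of \<open>\<rho>\<close>, have a real limit point \<open>\<eta>\<close>, and \<open>h / \<rho>\<close> tends to
  the leading form of \<open>h\<close> at \<open>\<eta>\<close>.\<close>
lemma (in infinite_ordering) weighted_elliptic_unbounded:
  assumes rho: "\<rho> = power_sum K"
    and K: "\<And>i. even (K i)" "\<And>i. K i > 0" "\<And>i. W i * K i = m" and "m > 0"
    and weight: "\<And>\<alpha>. \<alpha> \<in> Poly_Mapping.keys h \<Longrightarrow> monom_weight W \<alpha> \<le> m"
    and pos: "\<And>\<eta>. \<eta> \<noteq> 0 \<Longrightarrow> weighted_form W m h \<eta> > 0"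
  shows "mpoly_const d - h \<notin> P"
proof
  assume dh: "mpoly_const d - h \<in> P"
  have "\<exists>r\<ge>0. asymp 1 (mpoly_var i ^ K i) r" for i
    by (rule asymp_exists) (simp_all add: rho power_sum_minus_mem[OF preord] even_power_mem[OF preord] K)
  then obtain r where r: "\<And>i. r i \<ge> 0" "\<And>i. asymp 1 (mpoly_var i ^ K i) (r i)" by metis
  \<comment> \<open>Products of asymptotics are available for members of \<open>P\<close> only, so
    each variable gets a sign; \<open>m\<close> is even, hence the signs disappear in m-th
    powers.\<close>
  have "\<exists>s\<in>{1, -1}. mpoly_const s * mpoly_var i \<in> P" for i
    using total[of "mpoly_var i"] by (auto simp: mpoly_const_1 mpoly_const_minus)
  then obtain s where s: "\<And>i. s i = 1 \<or> s i = - 1" "\<And>i. mpoly_const (s i) * mpoly_var i \<in> P"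
    by (metis insert_iff empty_iff)
  have "even m" using K(1)[of undefined] K(3)[of undefined] by auto
  have sm: "s i ^ m = 1" for i using s(1)[of i] \<open>even m\<close> by auto
  \<comment> \<open>Since x_i^(K i) has size \<open>r i\<close> times \<open>\<rho>\<close>, the
    root is the coefficient of |x_i| relative to the formal power of \<open>\<rho>\<close> with
    exponent 1/K i.\<close>
  define \<eta> :: "real ^ 'n" where "\<eta> = (\<chi> i. s i * root (K i) (r i))"
  have "\<eta> \<noteq> 0"
  proof
    \<comment> \<open>Then all \<open>r i\<close> vanish, and their sum makes
      \<open>\<rho> / \<rho>\<close> infinitely close to 0.\<close>
    assume "\<eta> = 0"
    have "r i = 0" for i
    proof -
      have "\<eta> $ i = 0" using \<open>\<eta> = 0\<close> by simp
      then show ?thesis using s(1)[of i] K(2)[of i] by (auto simp: \<eta>_def)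
    qed
    moreover have "asymp 1 (\<Sum>i\<in>UNIV. mpoly_var i ^ K i) (\<Sum>i\<in>UNIV. r i)"
      by (intro asymp_sum r)
    moreover have "(\<Sum>i\<in>UNIV. mpoly_var i ^ K i) = \<rho>" by (simp only: rho power_sum_def)
    ultimately have "asymp 1 \<rho> 0" by simp
    from rho_const_mult_le[OF asympD(2)[OF this, of "1/2"], of 1] show False
      by (simp add: mpoly_const_1 zero_mem)
  qed
  have mono: "asymp 1 (Poly_Mapping.single \<alpha> c) (if monom_weight W \<alpha> = m then c * monom_eval \<alpha> \<eta> else 0)"
    if \<alpha>: "monom_weight W \<alpha> \<le> m" for \<alpha> c
  proof -
    define y where "y = (\<Prod>i\<in>UNIV. (mpoly_const (s i) * mpoly_var i) ^ Poly_Mapping.lookup \<alpha> i)"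
    have y: "y \<in> P" unfolding y_def by (intro prod_mem power_mem s)
    define S where "S = (\<Prod>i\<in>UNIV. r i ^ (Poly_Mapping.lookup \<alpha> i * W i))"
    define R where "R = (\<Prod>i\<in>UNIV. root (K i) (r i) ^ Poly_Mapping.lookup \<alpha> i)"
    have ym: "y ^ m = (\<Prod>i\<in>UNIV. (mpoly_var i ^ K i) ^ (Poly_Mapping.lookup \<alpha> i * W i))"
    proof (rule mpoly_eval_inject)
      fix x
      have "((s i * x $ i) ^ k) ^ m = ((x $ i) ^ K i) ^ (k * W i)" for i k
      proof -
        have "((s i * x $ i) ^ k) ^ m = (s i ^ m) ^ k * (x $ i) ^ (k * (W i * K i))"
          by (simp add: power_mult_distrib K(3) flip: power_mult) (simp add: mult.commute)
        then show ?thesis by (simp add: sm mult_ac flip: power_mult)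
      qed
      then show "mpoly_eval (y ^ m) x = mpoly_eval (\<Prod>i\<in>UNIV. (mpoly_var i ^ K i) ^ (Poly_Mapping.lookup \<alpha> i * W i)) x"
        by (simp add: y_def prod_power_distrib)
    qed
    have "asymp (\<Sum>i\<in>UNIV. 1 * (Poly_Mapping.lookup \<alpha> i * W i)) (y ^ m) S"
      unfolding ym S_def
      by (rule asymp_prod)
         (auto intro: power_mem[OF even_power_mem[OF preord K(1)]] r(1) zero_le_power
            asymp_power[OF even_power_mem[OF preord K(1)] r(1,2), unfolded mult_1]
          simp del: mpoly_eval_power)
    then have ymS: "asymp (monom_weight W \<alpha>) (y ^ m) S" by (simp only: monom_weight_def mult_1)
    have R: "R \<ge> 0" unfolding R_def by (rule prod_nonneg) (simp add: r(1) real_root_ge_zero)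
    have "(root (K i) (r i) ^ k) ^ m = r i ^ (k * W i)" for i k
    proof -
      have "(root (K i) (r i) ^ k) ^ m = (root (K i) (r i) ^ K i) ^ (k * W i)"
        by (simp only: power_mult[symmetric] K(3)[of i, symmetric] mult_ac)
      then show ?thesis using real_root_pow_pos2[OF K(2) r(1)] by simp
    qed
    then have RS: "R ^ m = S" by (simp add: R_def S_def prod_power_distrib)
    have y_asymp: "asymp 1 y (if monom_weight W \<alpha> = m then R else 0)"
    proof (cases "monom_weight W \<alpha> = m")
      case True
      then show ?thesis using asymp_root[OF y \<open>m > 0\<close> R RS] ymS by simp
    next
      case False
      then have "asymp m (y ^ m) 0" using asymp_negligible[OF power_mem[OF y] ymS] \<alpha> by simp
      then show ?thesis using asymp_root[OF y \<open>m > 0\<close>, of 0 0] False \<open>m > 0\<close> by simp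
    qed
    define \<sigma> where "\<sigma> = (\<Prod>i\<in>UNIV. s i ^ Poly_Mapping.lookup \<alpha> i)"
    have ss: "s i ^ k * s i ^ k = 1" for i k
      using s(1)[of i] by (auto simp flip: power_mult_distrib)
    have "Poly_Mapping.single \<alpha> c = mpoly_const (c * \<sigma>) * y"
    proof (rule mpoly_eval_inject)
      fix x
      have "\<sigma> * (\<Prod>i\<in>UNIV. (s i * x $ i) ^ Poly_Mapping.lookup \<alpha> i) = monom_eval \<alpha> x"
        unfolding \<sigma>_def monom_eval_def power_mult_distrib
        by (simp add: ss mult.assoc[symmetric] flip: prod.distrib)
      then show "mpoly_eval (Poly_Mapping.single \<alpha> c) x = mpoly_eval (mpoly_const (c * \<sigma>) * y) x"
        by (simp add: y_def mult.assoc)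
    qed
    moreover have "\<sigma> * R = monom_eval \<alpha> \<eta>"
      by (simp add: \<sigma>_def R_def monom_eval_def \<eta>_def power_mult_distrib prod.distrib)
    ultimately show ?thesis
      using asymp_const_mult[OF y_asymp, of "c * \<sigma>"] by (auto simp: mult.assoc)
  qed
  have "asymp 1 (\<Sum>\<alpha>\<in>Poly_Mapping.keys h. Poly_Mapping.single \<alpha> (Poly_Mapping.lookup h \<alpha>)) (weighted_form W m h \<eta>)"
    unfolding weighted_form_def by (intro asymp_sum mono weight)
  then have h: "asymp 1 h (weighted_form W m h \<eta>)" using mpoly_sum_monomials[of h] by simp
  \<comment> \<open>Strictly below the leading coefficient, so \<open>h\<close> dominates
    \<open>w\<close> times \<open>\<rho>\<close>; the constant \<open>(d + 1) / w\<close> then makes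
    three members of \<open>P\<close> add up to -1.\<close>
  define w where "w = weighted_form W m h \<eta> / 2"
  have w: "w > 0" "w < weighted_form W m h \<eta>" using pos[OF \<open>\<eta> \<noteq> 0\<close>] by (auto simp: w_def)
  have "(mpoly_const d - h) + (h - mpoly_const w * \<rho> ^ 1) + mpoly_const w * (\<rho> - mpoly_const ((d + 1) / w)) \<in> P"
    using w by (intro add_closed mult_closed const_mem dh infinite asympD(1)[OF h]) auto
  also have "(mpoly_const d - h) + (h - mpoly_const w * \<rho> ^ 1) + mpoly_const w * (\<rho> - mpoly_const ((d + 1) / w)) = mpoly_const (- 1)"
    by (rule mpoly_eval_inject) (use w(1) in \<open>simp add: field_simps\<close>)
  finally show False using const_neg[of "- 1"] by simp
qed

subsection \<open>Growth of convex polynomials\<close>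

lemma nonneg_poly_lead_coeff:
  fixes p :: "real poly"
  assumes "\<And>t. poly p t \<ge> 0" shows "lead_coeff p \<ge> 0"
proof (rule ccontr)
  assume "\<not> lead_coeff p \<ge> 0"
  then have "lead_coeff (- p) > 0" by simp
  then obtain n where "\<And>x. x \<ge> n \<Longrightarrow> poly (- p) x \<ge> lead_coeff (- p)" using poly_pinfty_gt_lc by blast
  from this[of n] \<open>lead_coeff (- p) > 0\<close> assms[of n] show False by simp
qed

text \<open>Replacing t by -t multiplies the leading coefficient by (-1)^degree, and both leading
  coefficients are nonnegative.\<close>

lemma nonneg_poly_even_degree:
  fixes p :: "real poly"
  assumes "\<And>t. poly p t \<ge> 0" shows "even (degree p)"
proof (cases "p = 0")
  case False
  let ?q = "pcompose p [:0, -1:]"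
  have "lead_coeff ?q = lead_coeff p * (- 1) ^ degree p" by (subst lead_coeff_comp) auto
  moreover have "lead_coeff ?q \<ge> 0" by (rule nonneg_poly_lead_coeff) (simp add: poly_pcompose assms)
  moreover have "lead_coeff p > 0"
    using nonneg_poly_lead_coeff[of p] assms False by (simp add: less_le)
  ultimately show ?thesis by (cases "even (degree p)") auto
qed simp

lemma poly_le_degree_le:
  fixes p q :: "real poly"
  assumes "\<And>t. 0 \<le> poly p t" "\<And>t. poly p t \<le> poly q t"
  shows "degree p \<le> degree q"
proof (rule ccontr)
  assume *: "\<not> degree p \<le> degree q"
  then have "lead_coeff p > 0"
    using nonneg_poly_lead_coeff[of p] assms by (auto simp: less_le)
  have "degree (q - p) = degree p" using * degree_add_eq_right[of q "- p"] by simp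
  then have "lead_coeff (q - p) = - lead_coeff p" using * by (simp add: coeff_eq_0)
  moreover have "lead_coeff (q - p) \<ge> 0" by (rule nonneg_poly_lead_coeff) (simp add: assms)
  ultimately show False using \<open>lead_coeff p > 0\<close> by simp
qed

lemma poly_le_coeff_le:
  fixes p q :: "real poly"
  assumes "\<And>t. poly p t \<le> poly q t" "degree p \<le> m" "degree q \<le> m"
  shows "coeff p m \<le> coeff q m"
proof (cases "degree (q - p) = m")
  case True
  have "lead_coeff (q - p) \<ge> 0" by (rule nonneg_poly_lead_coeff) (simp add: assms)
  with True show ?thesis by simp
next
  case False
  then have "degree (q - p) < m" using degree_diff_le[of q m p] assms by simp
  then have "coeff (q - p) m = 0" by (rule coeff_eq_0)
  then show ?thesis by simp
qed

text \<open>The restriction of \<open>p\<close> to the curve with coordinates t^(W i) x_i. Its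
  coefficients are the weighted parts of \<open>p\<close> at \<open>x\<close>, so facts about
  univariate degrees and leading coefficients apply to weighted forms.\<close>

definition weight_poly :: "('n \<Rightarrow> nat) \<Rightarrow> 'n::finite real_mpoly \<Rightarrow> real ^ 'n \<Rightarrow> real poly" where
  "weight_poly W p x =
     (\<Sum>\<alpha>\<in>Poly_Mapping.keys p. monom (Poly_Mapping.lookup p \<alpha> * monom_eval \<alpha> x) (monom_weight W \<alpha>))"

definition line_poly :: "'n::finite real_mpoly \<Rightarrow> real ^ 'n \<Rightarrow> real poly" where
  "line_poly = weight_poly (\<lambda>_. 1)"

lemma monom_eval_weight: "monom_eval \<alpha> (\<chi> i. t ^ W i * x $ i) = t ^ monom_weight W \<alpha> * monom_eval \<alpha> x"
  by (simp add: monom_eval_def monom_weight_def power_mult_distrib prod.distrib power_sum mult.commute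
      flip: power_mult)

lemma poly_weight_poly: "poly (weight_poly W p x) t = mpoly_eval p (\<chi> i. t ^ W i * x $ i)"
  by (simp only: weight_poly_def mpoly_eval_eq poly_sum poly_monom monom_eval_weight) (simp only: mult_ac)

lemma poly_line_poly: "poly (line_poly p x) t = mpoly_eval p (t *\<^sub>R x)"
proof -
  have "(\<chi> i. t ^ 1 * x $ i) = t *\<^sub>R x" by (simp add: vec_eq_iff)
  then show ?thesis by (simp only: line_poly_def poly_weight_poly)
qed

lemma coeff_weight_poly: "coeff (weight_poly W p x) k = weighted_form W k p x"
  by (simp add: weight_poly_def weighted_form_def coeff_sum)

lemma continuous_on_weighted_form: "continuous_on S (weighted_form W m p)"
proof -
  have "continuous_on S (monom_eval \<alpha>)" for \<alpha> :: "'a \<Rightarrow>\<^sub>0 nat"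
    unfolding monom_eval_def by (intro continuous_intros)
  then show ?thesis
    unfolding weighted_form_def
  proof (intro continuous_on_sum)
    fix \<alpha>
    show "continuous_on S (\<lambda>x. if monom_weight W \<alpha> = m then Poly_Mapping.lookup p \<alpha> * monom_eval \<alpha> x else 0)"
      using \<open>continuous_on S (monom_eval \<alpha>)\<close>
      by (cases "monom_weight W \<alpha> = m") (auto intro: continuous_on_mult_left)
  qed
qed

text \<open>The weights are inversely proportional to the axis degrees, so every power x_i^(K i) has
  weight \<open>m\<close>. The condition \<open>adapted\<close> excludes directions in which the
  growth of the axes involved cancels.\<close>

locale adapted_convex_poly =
  fixes h :: "'n::finite real_mpoly" and K W :: "'n \<Rightarrow> nat" and m :: nat
  assumes convex: "convex_on UNIV (mpoly_eval h)"
    and nonneg: "mpoly_eval h x \<ge> 0"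
    and zero: "mpoly_eval h 0 = 0"
    and K: "K i = degree (line_poly h (axis i 1))" "K i > 0"
    and adapted: "v $ i \<noteq> 0 \<Longrightarrow> K i \<le> degree (line_poly h v)"
    and W: "W i * K i = m" and m_pos: "m > 0"
begin

lemma K_even: "even (K i)"
  unfolding K(1) by (rule nonneg_poly_even_degree) (simp add: poly_line_poly nonneg)

text \<open>The curve point is the average of the n axis points n t^(W i) x_i e_i, with n the number
  of variables. By Jensen's inequality the nonnegative \<open>weight_poly\<close> lies below
  \<open>q\<close>, whose summands have degree at most \<open>W i * K i = m\<close>.\<close>

lemma degree_weight_poly: "degree (weight_poly W h x) \<le> m"
proof -
  define n where "n = real CARD('n)"
  have "n > 0" by (simp add: n_def)
  define q where "q = (\<Sum>i\<in>UNIV. smult (1 / n) (pcompose (line_poly h (axis i 1)) (monom (n * x $ i) (W i))))"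
  have "degree (weight_poly W h x) \<le> degree q"
  proof (rule poly_le_degree_le)
    fix t
    show "poly (weight_poly W h x) t \<ge> 0" by (simp add: poly_weight_poly nonneg)
    define y where "y = (\<lambda>i. (n * x $ i * t ^ W i) *\<^sub>R axis i 1 :: real ^ 'n)"
    have "(\<Sum>i\<in>UNIV. (1 / n) *\<^sub>R y i) = (\<chi> i. t ^ W i * x $ i)"
      using \<open>n > 0\<close> by (simp add: y_def vec_eq_iff axis_def if_distrib[where f = "\<lambda>z. _ * z"] cong: if_cong)
    moreover have "mpoly_eval h (\<Sum>i\<in>UNIV. (1 / n) *\<^sub>R y i) \<le> (\<Sum>i\<in>UNIV. (1 / n) * mpoly_eval h (y i))"
      by (rule convex_on_sum[OF _ _ convex]) (auto simp: n_def)
    ultimately show "poly (weight_poly W h x) t \<le> poly q t"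
      by (simp add: poly_weight_poly q_def poly_sum poly_pcompose poly_line_poly poly_monom y_def)
  qed
  also have "degree q \<le> m"
    unfolding q_def
  proof (rule degree_sum_le)
    fix i
    have "degree (pcompose (line_poly h (axis i 1)) (monom (n * x $ i) (W i))) \<le> K i * W i"
      unfolding K(1) by (rule order_trans[OF degree_pcompose_le mult_le_mono2[OF degree_monom_le]])
    then show "degree (smult (1 / n) (pcompose (line_poly h (axis i 1)) (monom (n * x $ i) (W i)))) \<le> m"
      using W[of i] degree_smult_le[of "1 / n"] by (metis mult.commute order_trans)
  qed simp
  finally show ?thesis .
qed

text \<open>A weighted part above \<open>m\<close> vanishes at every point by the degree bound,
  hence coefficientwise by independence of monomials.\<close>

lemma monom_weight_le:
  assumes "\<alpha> \<in> Poly_Mapping.keys h" shows "monom_weight W \<alpha> \<le> m"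
proof (rule ccontr)
  assume *: "\<not> monom_weight W \<alpha> \<le> m"
  have "(\<Sum>\<beta>\<in>Poly_Mapping.keys h. (if monom_weight W \<beta> = monom_weight W \<alpha> then Poly_Mapping.lookup h \<beta> else 0) *
      monom_eval \<beta> x) = 0" for x
  proof -
    have "coeff (weight_poly W h x) (monom_weight W \<alpha>) = 0"
      using degree_weight_poly[of x] * by (intro coeff_eq_0) simp
    then show ?thesis
      unfolding coeff_weight_poly weighted_form_def by (simp add: if_distrib[where f = "\<lambda>z. z * _"] cong: if_cong)
  qed
  from sum_monom_eval_eq_0_imp[OF finite_keys this assms] assms show False
    by (simp add: in_keys_iff)
qed

lemma weighted_form_nonneg: "weighted_form W m h x \<ge> 0"
  using poly_le_coeff_le[of 0 "weight_poly W h x" m] degree_weight_poly[of x]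
  by (simp add: coeff_weight_poly poly_weight_poly nonneg)

lemma weighted_form_scale: "weighted_form W m h (\<chi> i. t ^ W i * x $ i) = t ^ m * weighted_form W m h x"
  unfolding weighted_form_def sum_distrib_left monom_eval_weight by (intro sum.cong refl) simp

text \<open>Convexity and the value 0 at the origin give h(l y) at most l h(y) along the weighted
  curve; compare the coefficients of t^m.\<close>

lemma weighted_form_star:
  assumes "0 \<le> l" "l \<le> 1" shows "weighted_form W m h (l *\<^sub>R x) \<le> l * weighted_form W m h x"
proof -
  have "coeff (weight_poly W h (l *\<^sub>R x)) m \<le> coeff (smult l (weight_poly W h x)) m"
  proof (rule poly_le_coeff_le)
    fix t
    let ?y = "\<chi> i. t ^ W i * x $ i"
    have "(\<chi> i. t ^ W i * (l *\<^sub>R x) $ i) = (1 - l) *\<^sub>R 0 + l *\<^sub>R ?y" by (simp add: vec_eq_iff)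
    then show "poly (weight_poly W h (l *\<^sub>R x)) t \<le> poly (smult l (weight_poly W h x)) t"
      using convex_onD[OF convex assms, of 0 ?y] by (simp add: poly_weight_poly zero)
  qed (use degree_weight_poly degree_smult_le order_trans in blast)+
  then show ?thesis by (simp add: coeff_weight_poly)
qed

text \<open>If the leading form vanished at \<open>\<eta>\<close>, it would vanish on the whole orbit of \<open>\<eta>\<close> under weighted scaling, and by
  convexity in the asymptotic direction of that orbit, which involves only coordinates of equal weight.\<close>
lemma weighted_form_pos:
  assumes "\<eta> \<noteq> 0" shows "weighted_form W m h \<eta> > 0"
proof (rule ccontr)
  assume "\<not> weighted_form W m h \<eta> > 0"
  then have w0: "weighted_form W m h \<eta> = 0" using weighted_form_nonneg[of \<eta>] by simp
  define W' where "W' = Max (W ` {i. \<eta> $ i \<noteq> 0})"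
  have "{i. \<eta> $ i \<noteq> 0} \<noteq> {}" using assms by (auto simp: vec_eq_iff)
  then have "W' \<in> W ` {i. \<eta> $ i \<noteq> 0}" unfolding W'_def by (intro Max_in) auto
  then obtain k where k: "\<eta> $ k \<noteq> 0" "W' = W k" by auto
  have W': "W i \<le> W'" if "\<eta> $ i \<noteq> 0" for i unfolding W'_def using that by (intro Max_ge) auto
  \<comment> \<open>For 0 < r < 1 this is the orbit point with parameter 1/r, shrunk by
    \<open>r ^ W'\<close>: shrinking keeps the form at most 0, and as \<open>r\<close> tends to 0
    only coordinates of the largest weight survive. The truncated difference matters only where
    \<open>\<eta>\<close> has coordinate 0.\<close>
  define z where "z = (\<lambda>r::real. \<chi> i. r ^ (W' - W i) * \<eta> $ i)"
  have "weighted_form W m h (z r) \<le> 0" if "0 < r" "r < 1" for r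
  proof -
    let ?s = "\<chi> i. (1 / r) ^ W i * \<eta> $ i"
    have "z r $ i = (r ^ W' *\<^sub>R ?s) $ i" for i
    proof (cases "\<eta> $ i = 0")
      case False
      then have "r ^ W' = r ^ (W' - W i) * r ^ W i" using W'[of i] by (simp flip: power_add)
      then show ?thesis using that by (simp add: z_def power_one_over)
    qed (simp add: z_def)
    then have "z r = r ^ W' *\<^sub>R ?s" by (simp add: vec_eq_iff)
    then show ?thesis
      using weighted_form_star[of "r ^ W'" ?s] that weighted_form_scale[of "1 / r" \<eta>] w0
      by (simp add: power_le_one)
  qed
  then have "\<forall>\<^sub>F r in at_right 0. weighted_form W m h (z r) \<le> 0"
    by (auto simp: eventually_at_right[of 0 1] intro!: exI[of _ 1])
  moreover have "((\<lambda>r. weighted_form W m h (z r)) \<longlongrightarrow> weighted_form W m h (z 0)) (at_right 0)"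
  proof -
    have "continuous_on UNIV z" unfolding z_def by (intro continuous_intros)
    then have "continuous_on UNIV (\<lambda>r. weighted_form W m h (z r))"
      by (rule continuous_on_compose2[OF continuous_on_weighted_form[of UNIV]]) simp
    then show ?thesis
      by (metis UNIV_I continuous_on_def tendsto_within_subset subset_UNIV)
  qed
  ultimately have "weighted_form W m h (z 0) \<le> 0"
    by (intro tendsto_upperbound[where F = "at_right 0"]) auto
  then have wz: "weighted_form W m h (z 0) = 0" using weighted_form_nonneg[of "z 0"] by simp
  have "z 0 $ k = \<eta> $ k" by (simp add: z_def k)
  with k have zk: "z 0 $ k \<noteq> 0" by simp
  have supp: "W i = W'" if "z 0 $ i \<noteq> 0" for i
    using that W'[of i] by (auto simp: z_def power_0_left split: if_splits)
  have "W' > 0" using W[of k] m_pos k by (cases "W' = 0") auto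
  \<comment> \<open>At \<open>z 0\<close> only variables of weight \<open>W'\<close> count, so
    weight is proportional to degree and the weighted form is the homogeneous part of degree
    \<open>K k\<close>.\<close>
  have wt: "monom_weight W \<alpha> = monom_degree \<alpha> * W'" if "monom_eval \<alpha> (z 0) \<noteq> 0" for \<alpha>
  proof -
    have *: "Poly_Mapping.lookup \<alpha> i * W i = Poly_Mapping.lookup \<alpha> i * W'" for i
    proof (cases "Poly_Mapping.lookup \<alpha> i = 0")
      case False
      have "(z 0 $ i) ^ Poly_Mapping.lookup \<alpha> i \<noteq> 0" using that by (simp add: monom_eval_def)
      with False supp[of i] show ?thesis by simp
    qed simp
    show ?thesis by (simp only: monom_weight_def monom_degree_def sum_distrib_right *)
  qed
  have m: "m = K k * W'" using W[of k] k by (simp add: mult.commute)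
  have deg1: "monom_weight (\<lambda>_. 1) \<alpha> = monom_degree \<alpha>" for \<alpha> :: "'n \<Rightarrow>\<^sub>0 nat"
    by (simp add: monom_weight_def monom_degree_def)
  have "degree (line_poly h (z 0)) \<le> K k"
  proof (rule degree_le, intro allI impI)
    fix e assume "K k < e"
    have "Poly_Mapping.lookup h \<alpha> * monom_eval \<alpha> (z 0) = 0"
      if "\<alpha> \<in> Poly_Mapping.keys h" "monom_degree \<alpha> = e" for \<alpha>
    proof (rule ccontr)
      assume "Poly_Mapping.lookup h \<alpha> * monom_eval \<alpha> (z 0) \<noteq> 0"
      then have "e * W' \<le> K k * W'" using wt[of \<alpha>] that monom_weight_le[of \<alpha>] m by simp
      with \<open>W' > 0\<close> \<open>K k < e\<close> show False by simp
    qed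
    then show "coeff (line_poly h (z 0)) e = 0"
      unfolding line_poly_def coeff_weight_poly weighted_form_def deg1 by (intro sum.neutral) auto
  qed
  moreover have "coeff (line_poly h (z 0)) (K k) = 0"
  proof -
    have "weighted_form (\<lambda>_. 1) (K k) h (z 0) = weighted_form W m h (z 0)"
      unfolding weighted_form_def deg1
    proof (intro sum.cong refl)
      fix \<alpha>
      show "(if monom_degree \<alpha> = K k then Poly_Mapping.lookup h \<alpha> * monom_eval \<alpha> (z 0) else 0) =
          (if monom_weight W \<alpha> = m then Poly_Mapping.lookup h \<alpha> * monom_eval \<alpha> (z 0) else 0)"
        using wt[of \<alpha>] \<open>W' > 0\<close> by (cases "monom_eval \<alpha> (z 0) = 0") (auto simp: m)
    qed
    then show ?thesis using wz by (simp only: line_poly_def coeff_weight_poly)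
  qed
  moreover have "K k \<le> degree (line_poly h (z 0))" by (rule adapted[OF zk])
  \<comment> \<open>The two bounds force degree \<open>K k\<close>, but the coefficient there is 0;
    so the polynomial is 0, although its degree is at least \<open>K k > 0\<close>.\<close>
  ultimately have "line_poly h (z 0) = 0" by (metis le_antisym leading_coeff_0_iff)
  with \<open>K k \<le> degree (line_poly h (z 0))\<close> K(2)[of k] show False by simp
qed

end

subsection \<open>Convex polynomials in adapted coordinates\<close>

lemma preordering_sos: "preordering (sos :: 'n::finite real_mpoly set)"
  by standard (auto intro: sos_add sos_mult sos_square)

context adapted_convex_poly
begin

lemma power_sum_bounded:
  "\<exists>N. mpoly_const N - power_sum K \<in> {a + b * (mpoly_const d - h) | a b. a \<in> sos \<and> b \<in> sos}" (is "\<exists>N. _ \<in> ?T")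
proof (rule ccontr)
  assume "\<not> ?thesis"
  then have unb: "mpoly_const N - power_sum K \<notin> ?T" for N by blast
  have T: "preordering ?T" by (rule preordering_adjoin[OF preordering_sos])
  obtain P where P: "preordering P" "?T \<subseteq> P" "- 1 \<notin> P" "\<And>a. a \<in> P \<or> - a \<in> P"
    "\<And>N. power_sum K - mpoly_const N \<in> P"
    using unbounded_total_preordering[of ?T K, OF T K_even K(2) unb] by blast
  interpret infinite_ordering P "power_sum K"
    by (intro infinite_ordering.intro infinite_ordering_axioms.intro P)
  have "mpoly_const d - h \<notin> P"
    by (rule weighted_elliptic_unbounded[OF refl K_even K(2) W m_pos monom_weight_le weighted_form_pos])
  moreover have "mpoly_const d - h \<in> ?T" by (rule adjoin_generator_mem[OF preordering_sos])
  ultimately show False using P(2) by blast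
qed

lemma mem_preordering_sublevel:
  assumes pd: "\<And>v. v \<noteq> 0 \<Longrightarrow> mpoly_hess h 0 v > 0"
  shows "h \<in> {a + b * (mpoly_const d - h) | a b. a \<in> sos \<and> b \<in> sos}" (is "h \<in> ?T")
proof -
  have T: "preordering ?T" by (rule preordering_adjoin[OF preordering_sos])
  interpret T: preordering ?T by (rule T)
  obtain N where N: "mpoly_const N - power_sum K \<in> ?T" using power_sum_bounded by blast
  have "\<forall>i. \<exists>M. mpoly_const M - mpoly_var i \<in> ?T \<and> mpoly_const M + mpoly_var i \<in> ?T"
    using var_bounded_if_power_sum_bounded[of ?T K, OF T K_even K(2) N]
    unfolding preordering_bounded_def by blast
  from choice[OF this] obtain M where M: "\<And>i. mpoly_const (M i) - mpoly_var i \<in> ?T"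
    "\<And>i. mpoly_const (M i) + mpoly_var i \<in> ?T" by blast
  define R where "R = 1 + (\<Sum>i\<in>UNIV. \<bar>M i\<bar>)"
  have "R > 0" unfolding R_def by (intro add_pos_nonneg sum_nonneg) auto
  have "M i \<le> R" for i
    using member_le_sum[of i UNIV "\<lambda>i. \<bar>M i\<bar>"] abs_ge_self[of "M i"] by (simp add: R_def)
  then have MR: "mpoly_const (R - M i) \<in> ?T" for i
    by (intro preordering_const_mem[OF T]) simp
  have eq: "mpoly_const R - mpoly_var i = (mpoly_const (M i) - mpoly_var i) + mpoly_const (R - M i)"
    "mpoly_const R + mpoly_var i = (mpoly_const (M i) + mpoly_var i) + mpoly_const (R - M i)" for i
    by (simp_all add: mpoly_const_diff)
  obtain F where F: "\<And>x. mpoly_eval h x = (\<Sum>i\<in>UNIV. \<Sum>j\<in>UNIV. x $ i * x $ j * mpoly_eval (F i j) x)"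
    "\<And>x v. v \<noteq> 0 \<Longrightarrow> (\<Sum>i\<in>UNIV. \<Sum>j\<in>UNIV. v $ i * v $ j * mpoly_eval (F i j) x) > 0"
    using convex_quadratic_form_representation[OF keys_degree_ge_2[OF zero nonneg] convex pd] by blast
  show ?thesis
  proof (rule positive_definite_form_mem_preordering[OF T \<open>R > 0\<close> _ _ F(2,1)])
    show "mpoly_const R - mpoly_var i \<in> ?T" "mpoly_const R + mpoly_var i \<in> ?T" for i
      unfolding eq by (rule T.add_closed[OF M(1) MR], rule T.add_closed[OF M(2) MR])
  qed
qed

end

section \<open>Linear changes of coordinates\<close>

lemma mpoly_hess_eqI:
  assumes "\<And>t. mpoly_eval p (x + t *\<^sub>R v) = mpoly_eval q (y + t *\<^sub>R w)"
  shows "mpoly_hess p x v = mpoly_hess q y w"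
proof -
  have "(\<Sum>i\<in>UNIV. v $ i * mpoly_eval (mpoly_deriv i p) (x + t *\<^sub>R v)) =
      (\<Sum>i\<in>UNIV. w $ i * mpoly_eval (mpoly_deriv i q) (y + t *\<^sub>R w))" for t
    by (rule DERIV_unique[OF mpoly_line_has_derivative]) (use mpoly_line_has_derivative[of q y w t] in \<open>simp add: assms\<close>)
  then have "mpoly_hess p (x + 0 *\<^sub>R v) v = mpoly_hess q (y + 0 *\<^sub>R w) w"
    by (intro DERIV_unique[OF mpoly_line_has_derivative2]) (use mpoly_line_has_derivative2[of w q y 0] in simp)
  then show ?thesis by simp
qed

lemma mpoly_hess_const_line:
  assumes "\<And>t. mpoly_eval p (x + t *\<^sub>R v) = c" shows "mpoly_hess p x v = 0"
  using mpoly_hess_eqI[of p x v "mpoly_const c" 0 0] assms by (simp add: mpoly_hess_def)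

text \<open>The exchange step for bases: expanding the new vector gives coefficients
  \<open>?y\<close> over the old family, and at \<open>k\<close> this is
  \<open>x k * a k\<close>.\<close>

lemma independent_family_replace:
  fixes B :: "'n::finite \<Rightarrow> 'a::real_vector"
  assumes ind: "\<And>x. (\<Sum>i\<in>UNIV. x i *\<^sub>R B i) = 0 \<Longrightarrow> \<forall>i. x i = 0"
    and "a k \<noteq> 0" and 0: "(\<Sum>i\<in>UNIV. x i *\<^sub>R (B(k := \<Sum>j\<in>UNIV. a j *\<^sub>R B j)) i) = 0"
  shows "\<forall>i. x i = 0"
proof -
  let ?y = "\<lambda>i. (if i = k then 0 else x i) + x k * a i"
  have "(\<Sum>i\<in>UNIV. x i *\<^sub>R (B(k := \<Sum>j\<in>UNIV. a j *\<^sub>R B j)) i) =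
      x k *\<^sub>R (\<Sum>j\<in>UNIV. a j *\<^sub>R B j) + (\<Sum>i\<in>UNIV-{k}. x i *\<^sub>R B i)"
    by (subst sum.remove[of UNIV k]) auto
  also have "(\<Sum>i\<in>UNIV-{k}. x i *\<^sub>R B i) = (\<Sum>i\<in>UNIV. (if i = k then 0 else x i) *\<^sub>R B i)"
    by (rule sum.mono_neutral_cong_left) auto
  also have "x k *\<^sub>R (\<Sum>j\<in>UNIV. a j *\<^sub>R B j) + \<dots> = (\<Sum>i\<in>UNIV. ?y i *\<^sub>R B i)"
    by (simp only: scaleR_sum_right scaleR_add_left sum.distrib scaleR_scaleR add.commute)
  finally have y: "?y i = 0" for i using ind[of ?y] 0 by simp
  from y[of k] \<open>a k \<noteq> 0\<close> have "x k = 0" by simp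
  with y show ?thesis by (metis add.right_neutral mult_zero_left)
qed

lemma linear_family_bij:
  fixes B :: "'n::finite \<Rightarrow> real ^ 'n"
  assumes ind: "\<And>x. (\<Sum>i\<in>UNIV. x i *\<^sub>R B i) = 0 \<Longrightarrow> \<forall>i. x i = 0"
  obtains S where "linear S" "\<And>y. (\<Sum>i\<in>UNIV. S y $ i *\<^sub>R B i) = y"
proof -
  let ?f = "\<lambda>x :: real ^ 'n. \<Sum>i\<in>UNIV. x $ i *\<^sub>R B i"
  have lin: "linear ?f"
    by (rule linearI) (simp_all add: scaleR_add_left sum.distrib scaleR_sum_right)
  have "inj ?f"
    unfolding linear_injective_0[OF lin] using ind by (auto simp: vec_eq_iff)
  then obtain S where "linear S" "\<forall>x. S (?f x) = x" "\<forall>x. ?f (S x) = x"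
    using linear_injective_isomorphism[OF lin] by blast
  then show ?thesis using that by blast
qed

lemma convex_on_sum_functions:
  assumes "convex S" "\<And>i. i \<in> I \<Longrightarrow> convex_on S (f i)"
  shows "convex_on S (\<lambda>x. \<Sum>i\<in>I. f i x)"
  using assms(2)
  by (induction I rule: infinite_finite_induct) (auto intro: convex_on_add simp: convex_on_const assms(1))

lemma convex_on_affine_compose:
  fixes A :: "'a::real_vector \<Rightarrow> 'b::real_vector"
  assumes "convex_on UNIV f" "linear A"
  shows "convex_on UNIV (\<lambda>x. f (b + A x))"
proof (rule convex_onI)
  fix t x y assume t: "0 < (t::real)" "t < 1"
  have "b + A ((1 - t) *\<^sub>R x + t *\<^sub>R y) = (1 - t) *\<^sub>R (b + A x) + t *\<^sub>R (b + A y)"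
    unfolding linear_add[OF assms(2)] linear_scale[OF assms(2)] by (simp add: algebra_simps)
  then show "f (b + A ((1 - t) *\<^sub>R x + t *\<^sub>R y)) \<le> (1 - t) * f (b + A x) + t * f (b + A y)"
    using convex_onD[OF assms(1), of t "b + A x" "b + A y"] t by simp
qed simp

text \<open>Among all bases, one minimising the total degree of \<open>p\<close> along the basis directions makes the restriction of
  \<open>p\<close> to any line grow at least as fast as along each basis direction involved.\<close>

lemma convex_mem_sublevel_preordering:
  fixes p :: "'n::finite real_mpoly"
  assumes conv: "convex_on UNIV (mpoly_eval p)"
    and nonneg: "\<And>x. mpoly_eval p x \<ge> 0" and zero: "mpoly_eval p x0 = 0"
    and pd: "\<And>v. v \<noteq> 0 \<Longrightarrow> mpoly_hess p x0 v > 0"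
  obtains a b where "a \<in> sos" "b \<in> sos" "p = a + b * (mpoly_const d - p)"
proof -
  define ind where "ind = (\<lambda>B :: 'n \<Rightarrow> real ^ 'n. \<forall>x. (\<Sum>i\<in>UNIV. x i *\<^sub>R B i) = 0 \<longrightarrow> (\<forall>i. x i = 0))"
  define q where "q = mpoly_subst (\<lambda>i. mpoly_const (x0 $ i) + mpoly_var i) p"
  have q: "mpoly_eval q x = mpoly_eval p (x0 + x)" for x
    by (simp add: q_def plus_vec_def)
  have "ind (\<lambda>i. axis i 1)"
    by (auto simp: ind_def vec_eq_iff axis_def if_distrib[where f = "\<lambda>z. _ * z"] cong: if_cong)
  then obtain B where B: "ind B"
    and min: "\<And>B'. ind B' \<Longrightarrow> (\<Sum>i\<in>UNIV. degree (line_poly q (B i))) \<le> (\<Sum>i\<in>UNIV. degree (line_poly q (B' i)))"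
    using ex_has_least_nat[of ind _ "\<lambda>B. \<Sum>i\<in>UNIV. degree (line_poly q (B i))"] by blast
  define A where "A = (\<lambda>x :: real ^ 'n. \<Sum>j\<in>UNIV. x $ j *\<^sub>R B j)"
  have A: "linear A" unfolding A_def
    by (rule linearI) (simp_all add: scaleR_add_left sum.distrib scaleR_sum_right)
  obtain S where S: "linear S" "\<And>y. A (S y) = y"
    using linear_family_bij[of B] B unfolding ind_def A_def by blast
  have A_inj: "A v \<noteq> 0" if "v \<noteq> 0" for v
    using that B by (auto simp: A_def ind_def vec_eq_iff)
  have A_axis: "A (axis i 1) = B i" for i
    by (simp add: A_def axis_def if_distrib[where f = "\<lambda>z. z *\<^sub>R _"] cong: if_cong)
  define h where "h = mpoly_subst (\<lambda>i. mpoly_const (x0 $ i) + (\<Sum>j\<in>UNIV. mpoly_const (B j $ i) * mpoly_var j)) p"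
  have h: "mpoly_eval h x = mpoly_eval p (x0 + A x)" for x
  proof -
    have "(\<chi> i. x0 $ i + (\<Sum>j\<in>UNIV. B j $ i * x $ j)) = x0 + A x"
      by (simp add: vec_eq_iff A_def mult.commute)
    then show ?thesis by (simp add: h_def)
  qed
  have line: "line_poly h v = line_poly q (A v)" for v
    by (rule poly_eq_poly_eq_iff[THEN iffD1]) (simp add: fun_eq_iff poly_line_poly h q linear_scale[OF A])
  \<comment> \<open>Comparing restrictions to corresponding lines replaces a chain rule for second
    derivatives.\<close>
  have hess: "mpoly_hess h 0 v = mpoly_hess p x0 (A v)" for v
    by (rule mpoly_hess_eqI) (simp add: h linear_scale[OF A])
  have hess_pos: "mpoly_hess h 0 v > 0" if "v \<noteq> 0" for v
    unfolding hess by (rule pd[OF A_inj[OF that]])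
  define K where "K = (\<lambda>i. degree (line_poly h (axis i 1)))"
  have K_pos: "K i > 0" for i
  proof (rule ccontr)
    assume "\<not> K i > 0"
    then obtain c where c: "line_poly h (axis i 1) = [:c:]"
      using degree_eq_zeroE[of "line_poly h (axis i 1)"] by (auto simp: K_def)
    have "mpoly_eval h (0 + t *\<^sub>R axis i 1) = c" for t
      using poly_line_poly[of h "axis i 1" t] by (simp add: c)
    then have "mpoly_hess h 0 (axis i 1) = 0" by (rule mpoly_hess_const_line)
    with hess_pos[of "axis i 1"] show False by simp
  qed
  \<comment> \<open>The product of all axis degrees makes every weight \<open>m / K i\<close> a
    natural number.\<close>
  define m where "m = (\<Prod>i\<in>UNIV. K i)"
  define W where "W = (\<lambda>i. \<Prod>j\<in>UNIV-{i}. K j)"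
  interpret adapted_convex_poly h K W m
  proof
    show "convex_on UNIV (mpoly_eval h)"
      using convex_on_affine_compose[OF conv A, of x0] by (simp add: h[abs_def])
    show "mpoly_eval h x \<ge> 0" for x by (simp add: h nonneg)
    show "mpoly_eval h 0 = 0" by (simp add: h zero linear_0[OF A])
    show "K i = degree (line_poly h (axis i 1))" "K i > 0" for i by (simp add: K_def, rule K_pos)
    show "W i * K i = m" for i
      unfolding W_def m_def by (subst prod.remove[of UNIV i]) (auto simp: mult.commute)
    show "m > 0" unfolding m_def by (intro prod_pos) (simp add: K_pos)
    fix v :: "real ^ 'n" and i assume v: "v $ i \<noteq> 0"
    \<comment> \<open>Because \<open>v $ i\<close> is nonzero, \<open>A v\<close> may replace the
      i-th basis vector; minimality of the total degree then compares just these two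
      directions.\<close>
    let ?B' = "B(i := A v)"
    have "ind ?B'"
      using independent_family_replace[of B "\<lambda>j. v $ j" i] B v unfolding ind_def A_def by blast
    from min[OF this] have "(\<Sum>j\<in>UNIV. degree (line_poly q (B j))) \<le> (\<Sum>j\<in>UNIV. degree (line_poly q (?B' j)))" .
    also have "\<dots> = degree (line_poly q (A v)) + (\<Sum>j\<in>UNIV-{i}. degree (line_poly q (B j)))"
      by (subst sum.remove[of UNIV i]) auto
    also have "(\<Sum>j\<in>UNIV. degree (line_poly q (B j))) =
        degree (line_poly q (B i)) + (\<Sum>j\<in>UNIV-{i}. degree (line_poly q (B j)))"
      by (subst sum.remove[of UNIV i]) auto
    finally show "K i \<le> degree (line_poly h v)" by (simp add: K_def line A_axis)
  qed
  obtain a b where ab: "a \<in> sos" "b \<in> sos" "h = a + b * (mpoly_const d - h)"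
    using mem_preordering_sublevel[OF hess_pos, of d] by blast
  \<comment> \<open>The inverse change of coordinates, taking \<open>x\<close> to
    \<open>S (x - x0)\<close>.\<close>
  define \<theta> :: "'n \<Rightarrow> 'n real_mpoly" where
    "\<theta> = (\<lambda>i. \<Sum>j\<in>UNIV. mpoly_const (S (axis j 1) $ i) * (mpoly_var j - mpoly_const (x0 $ j)))"
  have \<theta>: "(\<chi> i. mpoly_eval (\<theta> i) x) = S (x - x0)" for x
  proof -
    have "S (x - x0) = S (\<Sum>j\<in>UNIV. (x - x0) $ j *\<^sub>R axis j 1)"
      using basis_expansion[of "x - x0"] by (simp only: scalar_mult_eq_scaleR)
    also have "\<dots> = (\<Sum>j\<in>UNIV. (x - x0) $ j *\<^sub>R S (axis j 1))"
      by (simp add: linear_sum[OF S(1)] linear_scale[OF S(1)])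
    finally show ?thesis by (simp add: vec_eq_iff \<theta>_def mult.commute)
  qed
  have hS: "mpoly_eval h (S (x - x0)) = mpoly_eval p x" for x
    by (simp add: h S)
  show ?thesis
  proof
    show "mpoly_subst \<theta> a \<in> sos" "mpoly_subst \<theta> b \<in> sos" by (simp_all add: ab sos_subst)
    show "p = mpoly_subst \<theta> a + mpoly_subst \<theta> b * (mpoly_const d - p)"
    proof (rule mpoly_eval_inject)
      fix x
      have "mpoly_eval h (S (x - x0)) = mpoly_eval (a + b * (mpoly_const d - h)) (S (x - x0))"
        using ab(3) by simp
      then show "mpoly_eval p x = mpoly_eval (mpoly_subst \<theta> a + mpoly_subst \<theta> b * (mpoly_const d - p)) x"
        by (simp add: \<theta> hS)
    qed
  qed
qed

section \<open>From the Lagrangian to the quadratic module\<close>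

theorem theorem3p1:
  fixes f :: "'n::finite real_mpoly"
    and g :: "'m::finite \<Rightarrow> 'n real_mpoly"
    and xs :: "real ^ 'n" and ls :: "real ^ 'm" and c :: real
  assumes "convex_on UNIV (mpoly_eval f)"
    and "\<And>i. convex_on UNIV (mpoly_eval (g i))"
    and "feasible_set g \<noteq> {}"
    and "xs \<in> feasible_set g"
    and "ls \<in> nonneg_orthant"
    and "saddle_point (lagrangian f g) xs ls"
    and "positive_definite (hessian (\<lambda>x. lagrangian f g x ls) xs)"
    and "c > mpoly_eval f xs"
  shows "f - mpoly_const (mpoly_eval f xs)
    \<in> quadratic_module (case_option (mpoly_const c - f) (\<lambda>i. - g i))"
proof -
  have ls: "ls $ i \<ge> 0" for i using assms(5) by (simp add: nonneg_orthant_def)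
  have gx: "mpoly_eval (g i) xs \<le> 0" for i using assms(4) by (simp add: feasible_set_def)
  have saddle: "lagrangian f g x ls \<ge> lagrangian f g xs ls" "lagrangian f g xs ls \<ge> lagrangian f g xs 0" for x
    using assms(6) by (auto simp: saddle_point_def nonneg_orthant_def)
  \<comment> \<open>Complementarity: feasibility bounds the sum by 0 from above, and the saddle
    inequality with multiplier 0 bounds it from below.\<close>
  have "(\<Sum>i\<in>UNIV. ls $ i * mpoly_eval (g i) xs) \<le> 0"
    using ls gx by (intro sum_nonpos) (simp add: mult_nonneg_nonpos)
  then have L_xs: "lagrangian f g xs ls = mpoly_eval f xs"
    using saddle(2) by (simp add: lagrangian_def)
  define p where "p = f + (\<Sum>i\<in>UNIV. mpoly_const (ls $ i) * g i) - mpoly_const (mpoly_eval f xs)"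
  have p: "mpoly_eval p x = lagrangian f g x ls - mpoly_eval f xs" for x
    by (simp add: p_def lagrangian_def)
  obtain a b where ab: "a \<in> sos" "b \<in> sos" "p = a + b * (mpoly_const (c - mpoly_eval f xs) - p)"
  proof (rule convex_mem_sublevel_preordering)
    have "convex_on UNIV (\<lambda>x. lagrangian f g x ls + (- mpoly_eval f xs))"
      unfolding lagrangian_def
      by (intro convex_on_add convex_on_sum_functions convex_on_cmul assms ls convex_on_const[THEN iffD2] convex_UNIV)
    then show "convex_on UNIV (mpoly_eval p)" by (simp add: p[abs_def])
    show "mpoly_eval p x \<ge> 0" for x using saddle(1)[of x] by (simp add: p L_xs)
    show "mpoly_eval p xs = 0" by (simp add: p L_xs)
    fix v :: "real ^ 'n" assume "v \<noteq> 0"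
    define L where "L = f + (\<Sum>i\<in>UNIV. mpoly_const (ls $ i) * g i)"
    have L: "(\<lambda>x. lagrangian f g x ls) = mpoly_eval L"
      by (simp add: fun_eq_iff L_def lagrangian_def)
    have "mpoly_deriv j p = mpoly_deriv j L" for j
    proof -
      have "mpoly_deriv j L = mpoly_deriv j (p + mpoly_const (mpoly_eval f xs))"
        by (simp add: p_def L_def)
      then show ?thesis
        unfolding mpoly_deriv_add by (simp add: mpoly_const_def mpoly_deriv_single)
    qed
    then have "mpoly_hess p xs v = v \<bullet> (hessian (\<lambda>x. lagrangian f g x ls) xs *v v)"
      unfolding L hessian_mpoly
      by (simp add: mpoly_hess_def inner_vec_def matrix_vector_mult_def sum_distrib_left mult_ac)
    then show "mpoly_hess p xs v > 0"
      using assms(7) \<open>v \<noteq> 0\<close> by (simp add: positive_definite_def)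
  qed
  \<comment> \<open>\<open>None\<close> stands for the generator \<open>c - f\<close>. Each
    \<open>- g i\<close> is used twice: with factor \<open>b\<close> inside the sublevel generator,
    and once more in passing from \<open>p\<close> to \<open>f - f(xs)\<close>.\<close>
  define \<sigma> where "\<sigma> = case_option b (\<lambda>i. b * mpoly_const (ls $ i) + mpoly_const (ls $ i))"
  have "f - mpoly_const (mpoly_eval f xs) =
      a + (\<Sum>k\<in>UNIV. \<sigma> k * case_option (mpoly_const c - f) (\<lambda>i. - g i) k)"
  proof -
    have d: "mpoly_const (c - mpoly_eval f xs) - p = (mpoly_const c - f) + (\<Sum>i\<in>UNIV. mpoly_const (ls $ i) * - g i)"
      by (simp add: p_def mpoly_const_diff sum_negf)
    have "f - mpoly_const (mpoly_eval f xs) = p + (\<Sum>i\<in>UNIV. mpoly_const (ls $ i) * - g i)"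
      by (simp add: p_def sum_negf)
    also have "p = a + b * ((mpoly_const c - f) + (\<Sum>i\<in>UNIV. mpoly_const (ls $ i) * - g i))"
      using ab(3) unfolding d .
    also have "a + b * ((mpoly_const c - f) + (\<Sum>i\<in>UNIV. mpoly_const (ls $ i) * - g i)) +
        (\<Sum>i\<in>UNIV. mpoly_const (ls $ i) * - g i) =
        a + (b * (mpoly_const c - f) + (\<Sum>i\<in>UNIV. (b * mpoly_const (ls $ i) + mpoly_const (ls $ i)) * - g i))"
      by (simp only: distrib_left distrib_right sum.distrib sum_distrib_left mult.assoc add.assoc)
    also have "b * (mpoly_const c - f) + (\<Sum>i\<in>UNIV. (b * mpoly_const (ls $ i) + mpoly_const (ls $ i)) * - g i) =
        (\<Sum>k\<in>UNIV. \<sigma> k * case_option (mpoly_const c - f) (\<lambda>i. - g i) k)"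
      unfolding UNIV_option_conv by (subst sum.insert) (auto simp: \<sigma>_def sum.reindex)
    finally show ?thesis .
  qed
  moreover have "\<sigma> k \<in> sos" for k
    using ab ls by (cases k) (auto simp: \<sigma>_def intro!: sos_add sos_mult sos_const)
  ultimately show ?thesis
    unfolding quadratic_module_def using ab(1) by blast
qed

end
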